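(* There exists $Z_{XY} \in \mathfrak{X}^{S^1}_1$ (that is, with $X$ a constant vector field inside $S^1$ and $Y$ an affine vector field with a singularity of saddle type and $\operatorname{div}(Y)=0$ outside $S^1$) that has exactly one crossing limit cycle that intersects $S^1$ in two points.
   Context: Let $S^1=\{(x,y)\in\mathbb R^2: x^2+y^2=1\}$ and $h(x,y)=x^2+y^2-1$. For smooth vector fields $X,Y$ on $\mathbb R^2$, $Z_{XY}$ denotes the piecewise smooth vector field equal to $X$ where $h\le 0$ and to $Y$ where $h\ge 0$, with Filippov's convention on $S^1$. Write $Xh=\langle X,\nabla h\rangle$ and $Yh=\langle Y,\nabla h\rangle$. The crossing region is $\{z\in S^1: Xh(z)\,Yh(z)>0\}$; there, trajectories of $X$ and $Y$ are concatenated. A crossing periodic orbit is a closed nonconstant trajectory of $Z_{XY}$, obtained by concatenating arcs of $X$-trajectories in $h\le 0$ and arcs of $Y$-trajectories in $h\ge 0$, that meets $S^1$ only at points of the crossing region. A crossing limit cycle is a crossing periodic orbit having a neighbourhood that contains no other periodic orbit. "Intersects $S^1$ in two points" means in exactly two distinct points. "Linear vector field" means an affine vector field $z\mapsto Az+b$. Its singularity is of saddle type if $A$ has real eigenvalues of opposite signs. $\mathfrak{X}^{S^1}_1$ is the set of $Z_{XY}$ with $X$ constant and $Y$ linear with a singularity of saddle type and $\operatorname{div}(Y)=0$. *)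

theory Defs
  imports "HOL-Analysis.Analysis"
begin

type_synonym vfield = "real^2 \<Rightarrow> real^2"

definition h :: "real^2 \<Rightarrow> real" where
  "h z = (z$1)\<^sup>2 + (z$2)\<^sup>2 - 1"

definition S1 :: "(real^2) set" where
  "S1 = {z. (z$1)\<^sup>2 + (z$2)\<^sup>2 = 1}"

definition grad_h :: vfield where
  "grad_h z = vector [2 * z$1, 2 * z$2]"

lemma gderiv_h: "GDERIV h z :> grad_h z"
  unfolding gderiv_def h_def grad_h_def
  by (auto intro!: derivative_eq_intros bounded_linear.has_derivative[OF bounded_linear_vec_nth]
      simp: inner_vec_def sum_2 vector_2 algebra_simps)

definition lie_h :: "vfield \<Rightarrow> real^2 \<Rightarrow> real" where
  "lie_h X z = X z \<bullet> grad_h z"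

definition crossing_region :: "vfield \<Rightarrow> vfield \<Rightarrow> (real^2) set" where
  "crossing_region X Y = {z \<in> S1. lie_h X z * lie_h Y z > 0}"

text \<open>The piecewise smooth vector field \<open>Z\<^sub>X\<^sub>Y\<close> is represented by the pair \<open>X\<close>, \<open>Y\<close>.
  Filippov's convention turns it into a differential inclusion whose right-hand side on
  the switching curve is the segment between the two one-sided values. On the part of \<open>S1\<close>
  where \<open>lie_h X\<close> and \<open>lie_h Y\<close> have opposite signs, the only element of this segment
  tangent to \<open>S1\<close> is the sliding vector field.\<close>

definition filippov_set :: "vfield \<Rightarrow> vfield \<Rightarrow> real^2 \<Rightarrow> (real^2) set" where
  "filippov_set X Y z =
     (if h z < 0 then {X z} else if h z > 0 then {Y z} else convex hull {X z, Y z})"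

text \<open>Absolutely continuous solutions on \<open>[0, T]\<close>, written as indefinite Lebesgue integrals.
  The inclusion is required at every time rather than at almost every time; this is no
  restriction, since \<open>filippov_set X Y z\<close> is never empty and \<open>g\<close> may be altered on a
  null set.\<close>

definition filippov_trajectory ::
    "vfield \<Rightarrow> vfield \<Rightarrow> real \<Rightarrow> (real \<Rightarrow> real^2) \<Rightarrow> bool" where
  "filippov_trajectory X Y T \<gamma> \<longleftrightarrow>
     (\<exists>g. g absolutely_integrable_on {0..T} \<and>
          (\<forall>t\<in>{0..T}. g t \<in> filippov_set X Y (\<gamma> t) \<and> \<gamma> t = \<gamma> 0 + integral {0..t} g))"

definition closed_trajectory ::
    "vfield \<Rightarrow> vfield \<Rightarrow> real \<Rightarrow> (real \<Rightarrow> real^2) \<Rightarrow> bool" where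
  "closed_trajectory X Y T \<gamma> \<longleftrightarrow>
     0 < T \<and> filippov_trajectory X Y T \<gamma> \<and> \<gamma> T = \<gamma> 0 \<and> (\<exists>t\<in>{0..T}. \<gamma> t \<noteq> \<gamma> 0)"

definition periodic_orbit :: "vfield \<Rightarrow> vfield \<Rightarrow> (real^2) set \<Rightarrow> bool" where
  "periodic_orbit X Y \<Gamma> \<longleftrightarrow> (\<exists>T \<gamma>. closed_trajectory X Y T \<gamma> \<and> \<Gamma> = \<gamma> ` {0..T})"

definition integral_curve_on ::
    "vfield \<Rightarrow> (real \<Rightarrow> real^2) \<Rightarrow> real \<Rightarrow> real \<Rightarrow> bool" where
  "integral_curve_on F \<gamma> a b \<longleftrightarrow>
     (\<forall>t\<in>{a..b}. (\<gamma> has_vector_derivative F (\<gamma> t)) (at t within {a..b}))"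

definition concatenation_of_arcs ::
    "vfield \<Rightarrow> vfield \<Rightarrow> real \<Rightarrow> (real \<Rightarrow> real^2) \<Rightarrow> bool" where
  "concatenation_of_arcs X Y T \<gamma> \<longleftrightarrow>
     (\<exists>(n::nat) \<tau>. \<tau> 0 = 0 \<and> \<tau> n = T \<and>
        (\<forall>i<n. \<tau> i < \<tau> (Suc i) \<and>
           (integral_curve_on X \<gamma> (\<tau> i) (\<tau> (Suc i)) \<and> (\<forall>t\<in>{\<tau> i..\<tau> (Suc i)}. h (\<gamma> t) \<le> 0) \<or>
            integral_curve_on Y \<gamma> (\<tau> i) (\<tau> (Suc i)) \<and> (\<forall>t\<in>{\<tau> i..\<tau> (Suc i)}. h (\<gamma> t) \<ge> 0))))"

definition crossing_periodic_orbit :: "vfield \<Rightarrow> vfield \<Rightarrow> (real^2) set \<Rightarrow> bool" where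
  "crossing_periodic_orbit X Y \<Gamma> \<longleftrightarrow>
     (\<exists>T \<gamma>. closed_trajectory X Y T \<gamma> \<and> concatenation_of_arcs X Y T \<gamma> \<and> \<Gamma> = \<gamma> ` {0..T}) \<and>
     \<Gamma> \<inter> S1 \<subseteq> crossing_region X Y"

definition crossing_limit_cycle :: "vfield \<Rightarrow> vfield \<Rightarrow> (real^2) set \<Rightarrow> bool" where
  "crossing_limit_cycle X Y \<Gamma> \<longleftrightarrow>
     crossing_periodic_orbit X Y \<Gamma> \<and>
     (\<exists>U. open U \<and> \<Gamma> \<subseteq> U \<and> (\<forall>\<Gamma>'. periodic_orbit X Y \<Gamma>' \<and> \<Gamma>' \<subseteq> U \<longrightarrow> \<Gamma>' = \<Gamma>))"

definition constant_field :: "vfield \<Rightarrow> bool" where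
  "constant_field X \<longleftrightarrow> (\<exists>c. \<forall>z. X z = c)"

definition eigenvalue :: "real^2^2 \<Rightarrow> real \<Rightarrow> bool" where
  "eigenvalue A l \<longleftrightarrow> (\<exists>v. v \<noteq> 0 \<and> A *v v = l *\<^sub>R v)"

definition affine_saddle :: "vfield \<Rightarrow> bool" where
  "affine_saddle Y \<longleftrightarrow>
     (\<exists>A b. (\<forall>z. Y z = A *v z + b) \<and> (\<exists>p. Y p = 0) \<and>
        (\<exists>l m. eigenvalue A l \<and> eigenvalue A m \<and> l < 0 \<and> 0 < m))"

definition divergence :: "vfield \<Rightarrow> real^2 \<Rightarrow> real" where
  "divergence F z = trace (jacobian F (at z))"

lemma divergence_affine: "divergence (\<lambda>z. A *v z + b) z = trace A"
proof -
  have "((\<lambda>z. A *v z + b) has_derivative (\<lambda>z. A *v z)) (at z)"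
    by (auto intro!: derivative_eq_intros bounded_linear_imp_has_derivative)
  then have "frechet_derivative (\<lambda>z. A *v z + b) (at z) = (\<lambda>z. A *v z)"
    by (rule frechet_derivative_at[symmetric])
  then show ?thesis
    by (simp add: divergence_def jacobian_def)
qed

definition X1S1 :: "(vfield \<times> vfield) set" where
  "X1S1 = {(X, Y). constant_field X \<and> affine_saddle Y \<and> (\<forall>z. divergence Y z = 0)}"

end

theory Submission imports Defs begin

text \<open>
  Let \<open>X = (0, 1)\<close>, and let \<open>Y\<close> be the Hamiltonian saddle whose first integral is the product of
  \<open>u = x + 2 y - 23/10\<close> and \<open>s = x - y - 31/20\<close>, so that \<open>u' = 3 u\<close> and \<open>s' = - 3 s\<close>.  Inside the disc a
  trajectory enters at some \<open>(x, - y)\<close> and leaves at the mirror image \<open>(x, y)\<close>; outside, \<open>u s\<close> is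
  constant.  On the circle \<open>u s\<close> equals \<open>3 x\<^sup>2 - 77/20 x + (x - 4/5) y\<close> up to a constant, so it agrees at
  \<open>(x, y)\<close> and \<open>(x, - y)\<close> only for \<open>x = 4/5\<close>; and the return map \<open>x \<mapsto> x'\<close> on the entry points with
  \<open>x > 39/50\<close> moves every point away from \<open>4/5\<close>.  A closed trajectory that crosses the circle only at such
  points therefore has all its entry points at \<open>x = 4/5\<close>, by looking at the largest and the smallest
  abscissa; if it meets the circle in two points only, this is immediate.  In both cases it is the cycle
  through \<open>(4/5, \<plusminus>3/5)\<close>.

  Filippov trajectories are only absolutely continuous, but near a crossing point \<open>z\<close> all admissible
  velocities \<open>v\<close> have \<open>w \<bullet> v\<close> of one strict sign for all \<open>w\<close> near \<open>z\<close>, so that \<open>h\<close> is strictly monotone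
  along the trajectory there.
\<close>

section \<open>Filippov trajectories\<close>

text \<open>The velocity \<open>g\<close> is explicit and integrates to the increment over every
  subinterval, so that trajectories can be restricted, shifted and glued by integral rules
  alone.\<close>

definition filippov_velocity ::
    "vfield \<Rightarrow> vfield \<Rightarrow> real \<Rightarrow> (real \<Rightarrow> real^2) \<Rightarrow> (real \<Rightarrow> real^2) \<Rightarrow> bool" where
  "filippov_velocity X Y T \<gamma> g \<longleftrightarrow>
     (\<forall>t\<in>{0..T}. g t \<in> filippov_set X Y (\<gamma> t)) \<and>
     (\<forall>s t. 0 \<le> s \<longrightarrow> s \<le> t \<longrightarrow> t \<le> T \<longrightarrow> (g has_integral (\<gamma> t - \<gamma> s)) {s..t})"

lemma filippov_trajectory_imp_velocity:
  assumes "filippov_trajectory X Y T \<gamma>"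
  obtains g where "filippov_velocity X Y T \<gamma> g"
proof -
  from assms obtain g where g: "g absolutely_integrable_on {0..T}"
      "\<And>t. t \<in> {0..T} \<Longrightarrow> g t \<in> filippov_set X Y (\<gamma> t)"
      "\<And>t. t \<in> {0..T} \<Longrightarrow> \<gamma> t = \<gamma> 0 + integral {0..t} g"
    unfolding filippov_trajectory_def by blast
  have gi: "g integrable_on {0..T}"
    using g(1) by (rule set_lebesgue_integral_eq_integral(1))
  have "(g has_integral (\<gamma> t - \<gamma> s)) {s..t}" if "0 \<le> s" "s \<le> t" "t \<le> T" for s t
  proof -
    have "g integrable_on {s..t}" "g integrable_on {0..t}"
      using gi that by (auto intro: integrable_on_subinterval)
    moreover from this have "integral {0..s} g + integral {s..t} g = integral {0..t} g"
      using that Henstock_Kurzweil_Integration.integral_combine by blast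
    moreover have "\<gamma> s = \<gamma> 0 + integral {0..s} g" "\<gamma> t = \<gamma> 0 + integral {0..t} g"
      using g(3)[of s] g(3)[of t] that by auto
    ultimately show ?thesis
      by (simp add: has_integral_iff algebra_simps)
  qed
  then show ?thesis
    using g(2) that unfolding filippov_velocity_def by blast
qed

lemma filippov_velocity_continuous:
  assumes "filippov_velocity X Y T \<gamma> g" "0 \<le> T"
  shows "continuous_on {0..T} \<gamma>"
proof -
  have gi: "(g has_integral (\<gamma> t - \<gamma> 0)) {0..t}" if "t \<in> {0..T}" for t
    using assms that unfolding filippov_velocity_def by auto
  have "g integrable_on {0..T}"
    using gi[of T] assms(2) by auto
  then have "continuous_on {0..T} (\<lambda>t. \<gamma> 0 + integral {0..t} g)"
    by (intro continuous_intros indefinite_integral_continuous_1)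
  moreover have "\<gamma> 0 + integral {0..t} g = \<gamma> t" if "t \<in> {0..T}" for t
    using integral_unique[OF gi[OF that]] by simp
  ultimately show ?thesis
    by (rule continuous_on_eq) auto
qed

text \<open>Moves the initial time of a closed trajectory, later to a time at which it lies on the
  circle.\<close>

lemma filippov_velocity_rotate:
  assumes v: "filippov_velocity X Y T \<gamma> g" and closed: "\<gamma> T = \<gamma> 0" and r: "r \<in> {0..T}"
  obtains \<gamma>' g' where "filippov_velocity X Y T \<gamma>' g'" "\<gamma>' 0 = \<gamma> r" "\<gamma>' T = \<gamma> r"
    "\<gamma>' ` {0..T} = \<gamma> ` {0..T}"
proof -
  define \<gamma>' where "\<gamma>' = (\<lambda>t. if t \<le> T - r then \<gamma> (t + r) else \<gamma> (t + (r - T)))"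
  define g' where "g' = (\<lambda>t. if t \<le> T - r then g (t + r) else g (t + (r - T)))"
  have int: "(g has_integral (\<gamma> t - \<gamma> s)) {s..t}" if "0 \<le> s" "s \<le> t" "t \<le> T" for s t
    using v that unfolding filippov_velocity_def by blast
  have late: "\<gamma>' t = \<gamma> (t + (r - T))" if "T - r \<le> t" for t
    using that closed by (auto simp: \<gamma>'_def)
  have 1: "(g' has_integral (\<gamma>' t - \<gamma>' s)) {s..t}" if "0 \<le> s" "s \<le> t" "t \<le> T - r" for s t
  proof -
    have "((\<lambda>x. g (x + r)) has_integral (\<gamma> (t + r) - \<gamma> (s + r))) {s..t}"
      using has_integral_shift_real_ivl[OF int[of "s + r" "t + r"], of r] that r by simp
    then have "(g' has_integral (\<gamma> (t + r) - \<gamma> (s + r))) {s..t}"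
      by (rule has_integral_eq[rotated]) (use that in \<open>auto simp: g'_def\<close>)
    then show ?thesis
      using that by (simp add: \<gamma>'_def)
  qed
  have 2: "(g' has_integral (\<gamma>' t - \<gamma>' s)) {s..t}" if "T - r \<le> s" "s \<le> t" "t \<le> T" for s t
  proof -
    have "((\<lambda>x. g (x + (r - T))) has_integral (\<gamma> (t + (r - T)) - \<gamma> (s + (r - T)))) {s..t}"
      using has_integral_shift_real_ivl[OF int[of "s + (r - T)" "t + (r - T)"], of "r - T"] that r
      by simp
    \<comment> \<open>At the seam \<open>T - r\<close> the path is consistent because it is closed,
      but \<open>g'\<close> takes the value \<open>g T\<close> there instead of \<open>g 0\<close>;
      one point is negligible.\<close>
    then have "(g' has_integral (\<gamma> (t + (r - T)) - \<gamma> (s + (r - T)))) {s..t}"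
      by (rule has_integral_spike_finite[where S="{T - r}", rotated 2])
        (use that in \<open>auto simp: g'_def\<close>)
    then show ?thesis
      using that late by simp
  qed
  have "(g' has_integral (\<gamma>' t - \<gamma>' s)) {s..t}" if "0 \<le> s" "s \<le> t" "t \<le> T" for s t
  proof -
    consider "t \<le> T - r" | "T - r \<le> s" | "s \<le> T - r" "T - r \<le> t" by linarith
    then show ?thesis
    proof cases
      case 3
      have "(g' has_integral ((\<gamma>' (T - r) - \<gamma>' s) + (\<gamma>' t - \<gamma>' (T - r)))) {s..t}"
        by (rule has_integral_combine[OF 3 1 2]) (use that 3 in auto)
      then show ?thesis by simp
    qed (use 1 2 that in auto)
  qed
  moreover have "g' t \<in> filippov_set X Y (\<gamma>' t)" if "t \<in> {0..T}" for t
    using v that r unfolding filippov_velocity_def g'_def \<gamma>'_def by auto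
  ultimately have "filippov_velocity X Y T \<gamma>' g'"
    unfolding filippov_velocity_def by blast
  moreover have "\<gamma>' 0 = \<gamma> r" "\<gamma>' T = \<gamma> r"
    using r closed late[of T] by (auto simp: \<gamma>'_def)
  moreover have "\<gamma>' ` {0..T} = \<gamma> ` {0..T}"
  proof (intro equalityI subsetI)
    fix z assume "z \<in> \<gamma>' ` {0..T}"
    then show "z \<in> \<gamma> ` {0..T}"
      using r by (auto simp: \<gamma>'_def)
  next
    fix z assume "z \<in> \<gamma> ` {0..T}"
    then obtain t where t: "t \<in> {0..T}" "z = \<gamma> t" by blast
    have "z = \<gamma>' (if r \<le> t then t - r else t + (T - r))"
      using t late[of "t + (T - r)"] by (auto simp: \<gamma>'_def)
    moreover have "(if r \<le> t then t - r else t + (T - r)) \<in> {0..T}"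
      using t r by auto
    ultimately show "z \<in> \<gamma>' ` {0..T}" by blast
  qed
  ultimately show ?thesis using that by blast
qed

lemma h_eq_inner: "h z = z \<bullet> z - 1"
  by (simp add: h_def inner_vec_def sum_2 power2_eq_square)

lemma continuous_on_h: "continuous_on A h"
  unfolding h_eq_inner by (intro continuous_intros)

lemma mem_S1_iff: "z \<in> S1 \<longleftrightarrow> h z = 0"
  by (simp add: S1_def h_def)

lemma lie_h_eq_inner: "lie_h F z = 2 * (z \<bullet> F z)"
  by (simp add: lie_h_def grad_h_def inner_vec_def sum_2 algebra_simps)

text \<open>The strict inequalities at \<gamma> \<open>t\<close> persist when the position and the
  base point of the velocity vary independently nearby. A half-space is convex, so the bound passes
  to the whole Filippov segment and can be integrated. The free time \<open>r\<close> later allows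
  either endpoint as the position.\<close>

lemma filippov_velocity_crossing_displacement:
  assumes v: "filippov_velocity X Y T \<gamma> g" and t: "t \<in> {0..T}"
    and cont: "continuous_on UNIV X" "continuous_on UNIV Y"
    and pos: "\<sigma> * lie_h X (\<gamma> t) > 0" "\<sigma> * lie_h Y (\<gamma> t) > 0"
  obtains e where "e > 0"
    "\<And>r s s'. r \<in> {0..T} \<Longrightarrow> \<bar>r - t\<bar> < e \<Longrightarrow> 0 \<le> s \<Longrightarrow> s < s' \<Longrightarrow> s' \<le> T \<Longrightarrow>
       \<bar>s - t\<bar> < e \<Longrightarrow> \<bar>s' - t\<bar> < e \<Longrightarrow> \<sigma> * (\<gamma> r \<bullet> (\<gamma> s' - \<gamma> s)) > 0"
proof -
  define z where "z = \<gamma> t"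
  \<comment> \<open>Half of the smaller value leaves room for the open condition that defines
    \<open>W\<close>.\<close>
  define c where "c = min (\<sigma> * (z \<bullet> X z)) (\<sigma> * (z \<bullet> Y z)) / 2"
  have c: "c > 0" "c < \<sigma> * (z \<bullet> X z)" "c < \<sigma> * (z \<bullet> Y z)"
    using pos by (auto simp: c_def z_def lie_h_eq_inner min_def algebra_simps)
  define W where "W = {p. c < \<sigma> * (fst p \<bullet> X (snd p))} \<inter> {p. c < \<sigma> * (fst p \<bullet> Y (snd p))}"
  have "open W"
    unfolding W_def
    by (intro open_Int open_Collect_less continuous_intros
        continuous_on_compose2[OF cont(1)] continuous_on_compose2[OF cont(2)]) auto
  moreover have "(z, z) \<in> W"
    using c by (simp add: W_def)
  ultimately obtain A B where AB: "open A" "open B" "z \<in> A" "z \<in> B" "A \<times> B \<subseteq> W"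
    by (rule open_prod_elim) auto
  have "continuous_on {0..T} \<gamma>"
    using filippov_velocity_continuous[OF v] t by auto
  then obtain e where e: "e > 0" "\<And>r. r \<in> {0..T} \<Longrightarrow> \<bar>r - t\<bar> < e \<Longrightarrow> \<gamma> r \<in> A \<inter> B"
  proof -
    assume c: "continuous_on {0..T} \<gamma>" and *: "\<And>e. e > 0 \<Longrightarrow> (\<And>r. r \<in> {0..T} \<Longrightarrow> \<bar>r - t\<bar> < e \<Longrightarrow> \<gamma> r \<in> A \<inter> B) \<Longrightarrow> thesis"
    have "\<forall>\<^sub>F r in at t within {0..T}. \<gamma> r \<in> A \<inter> B"
      using c t AB unfolding continuous_on_def z_def
      by (intro topological_tendstoD[of \<gamma> "\<gamma> t"]) auto
    then obtain d where "d > 0" "\<And>r. r \<in> {0..T} \<Longrightarrow> r \<noteq> t \<Longrightarrow> dist r t < d \<Longrightarrow> \<gamma> r \<in> A \<inter> B"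
      unfolding eventually_at by blast
    then show thesis
      using * AB t unfolding z_def dist_real_def by (metis IntI)
  qed
  show ?thesis
  proof (rule that[OF e(1)])
    fix r s s' assume r: "r \<in> {0..T}" "\<bar>r - t\<bar> < e"
      and s: "0 \<le> s" "s < s'" "s' \<le> T" "\<bar>s - t\<bar> < e" "\<bar>s' - t\<bar> < e"
    have ineq: "c \<le> \<sigma> * (\<gamma> r \<bullet> g q)" if "q \<in> {s..s'}" for q
    proof -
      have q: "q \<in> {0..T}" "\<bar>q - t\<bar> < e"
        using that s by auto
      have "(\<gamma> r, \<gamma> q) \<in> W"
        using e(2)[OF r] e(2)[OF q] AB(5) by auto
      then have XY: "{X (\<gamma> q), Y (\<gamma> q)} \<subseteq> {v. (\<sigma> *\<^sub>R \<gamma> r) \<bullet> v \<ge> c}"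
        by (auto simp: W_def)
      then have "convex hull {X (\<gamma> q), Y (\<gamma> q)} \<subseteq> {v. (\<sigma> *\<^sub>R \<gamma> r) \<bullet> v \<ge> c}"
        by (intro hull_minimal convex_halfspace_ge)
      moreover have "g q \<in> filippov_set X Y (\<gamma> q)"
        using v q unfolding filippov_velocity_def by blast
      ultimately show ?thesis
        using XY by (auto simp: filippov_set_def split: if_splits)
    qed
    have "(g has_integral (\<gamma> s' - \<gamma> s)) {s..s'}"
      using v s unfolding filippov_velocity_def by auto
    from has_integral_linear[OF this bounded_linear_inner_right, of "\<sigma> *\<^sub>R \<gamma> r"]
    have int: "((\<lambda>q. \<sigma> * (\<gamma> r \<bullet> g q)) has_integral (\<sigma> * (\<gamma> r \<bullet> (\<gamma> s' - \<gamma> s)))) {s..s'}"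
      by (simp add: o_def)
    have "((\<lambda>q. c) has_integral (c * (s' - s))) {s..s'}"
      using has_integral_const_real[of c s s'] s by (simp add: algebra_simps)
    from has_integral_le[OF this int ineq]
    have "c * (s' - s) \<le> \<sigma> * (\<gamma> r \<bullet> (\<gamma> s' - \<gamma> s))" .
    moreover have "c * (s' - s) > 0"
      using c s by simp
    ultimately show "\<sigma> * (\<gamma> r \<bullet> (\<gamma> s' - \<gamma> s)) > 0" by linarith
  qed
qed

text \<open>Both cases expand \<open>h\<close> about the endpoint at which the quadratic remainder has the
  favourable sign.\<close>

lemma filippov_velocity_crossing_monotone:
  assumes v: "filippov_velocity X Y T \<gamma> g" and t: "t \<in> {0..T}"
    and cont: "continuous_on UNIV X" "continuous_on UNIV Y"
    and pos: "\<sigma> * lie_h X (\<gamma> t) > 0" "\<sigma> * lie_h Y (\<gamma> t) > 0"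
  obtains e where "e > 0"
    "\<And>s s'. 0 \<le> s \<Longrightarrow> s < s' \<Longrightarrow> s' \<le> T \<Longrightarrow> \<bar>s - t\<bar> < e \<Longrightarrow> \<bar>s' - t\<bar> < e \<Longrightarrow>
       \<sigma> * h (\<gamma> s) < \<sigma> * h (\<gamma> s')"
proof -
  obtain e where e: "e > 0"
    "\<And>r s s'. r \<in> {0..T} \<Longrightarrow> \<bar>r - t\<bar> < e \<Longrightarrow> 0 \<le> s \<Longrightarrow> s < s' \<Longrightarrow> s' \<le> T \<Longrightarrow>
       \<bar>s - t\<bar> < e \<Longrightarrow> \<bar>s' - t\<bar> < e \<Longrightarrow> \<sigma> * (\<gamma> r \<bullet> (\<gamma> s' - \<gamma> s)) > 0"
    using filippov_velocity_crossing_displacement[OF assms] by blast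
  show ?thesis
  proof (rule that[OF e(1)])
    fix s s' assume s: "0 \<le> s" "s < s'" "s' \<le> T" "\<bar>s - t\<bar> < e" "\<bar>s' - t\<bar> < e"
    have 1: "\<sigma> * (\<gamma> s \<bullet> (\<gamma> s' - \<gamma> s)) > 0" and 2: "\<sigma> * (\<gamma> s' \<bullet> (\<gamma> s' - \<gamma> s)) > 0"
      using s by (auto intro!: e(2))
    have "\<sigma> * h (\<gamma> s') - \<sigma> * h (\<gamma> s) =
        2 * (\<sigma> * (\<gamma> s \<bullet> (\<gamma> s' - \<gamma> s))) + \<sigma> * ((\<gamma> s' - \<gamma> s) \<bullet> (\<gamma> s' - \<gamma> s))"
      "\<sigma> * h (\<gamma> s') - \<sigma> * h (\<gamma> s) =
        2 * (\<sigma> * (\<gamma> s' \<bullet> (\<gamma> s' - \<gamma> s))) - \<sigma> * ((\<gamma> s' - \<gamma> s) \<bullet> (\<gamma> s' - \<gamma> s))"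
      by (simp_all add: h_eq_inner inner_diff_left inner_diff_right inner_commute algebra_simps)
    moreover have "\<sigma> * ((\<gamma> s' - \<gamma> s) \<bullet> (\<gamma> s' - \<gamma> s)) \<ge> 0 \<or> \<sigma> * ((\<gamma> s' - \<gamma> s) \<bullet> (\<gamma> s' - \<gamma> s)) \<le> 0"
      by linarith
    ultimately show "\<sigma> * h (\<gamma> s) < \<sigma> * h (\<gamma> s')"
      using 1 2 by linarith
  qed
qed

text \<open>Strictly inside the disc the inclusion has the single value \<open>c\<close>; the two
  end times, where the segment may offer more, are negligible.\<close>

lemma filippov_velocity_inside:
  assumes v: "filippov_velocity (\<lambda>_. c) Y T \<gamma> g" and ab: "0 \<le> a" "a \<le> b" "b \<le> T"
    and inside: "\<And>s. s \<in> {a<..<b} \<Longrightarrow> h (\<gamma> s) < 0" and s: "s \<in> {a..b}"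
  shows "\<gamma> s = \<gamma> a + (s - a) *\<^sub>R c"
proof -
  have eq: "c = g r" if "r \<in> {a..s} - {a, b}" for r
  proof -
    have "r \<in> {a<..<b}" "r \<in> {0..T}"
      using that s ab by auto
    moreover from this have "g r \<in> filippov_set (\<lambda>_. c) Y (\<gamma> r)"
      using v unfolding filippov_velocity_def by blast
    ultimately show ?thesis
      using inside[of r] by (simp add: filippov_set_def)
  qed
  have "(g has_integral (\<gamma> s - \<gamma> a)) {a..s}"
    using v ab s unfolding filippov_velocity_def by auto
  then have "((\<lambda>_. c) has_integral (\<gamma> s - \<gamma> a)) {a..s}"
    by (rule has_integral_spike_finite[of "{a, b}", rotated 2]) (simp_all only: eq finite.intros)
  moreover have "((\<lambda>_. c) has_integral (s - a) *\<^sub>R c) {a..s}"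
    using has_integral_const_real[of c a s] s by simp
  ultimately have "\<gamma> s - \<gamma> a = (s - a) *\<^sub>R c"
    by (rule has_integral_unique)
  then show ?thesis by (simp add: algebra_simps)
qed

lemma filippov_velocity_outside:
  assumes v: "filippov_velocity X Y T \<gamma> g" and ab: "0 \<le> a" "a \<le> b" "b \<le> T"
    and cont: "continuous_on UNIV Y"
    and outside: "\<And>s. s \<in> {a<..<b} \<Longrightarrow> h (\<gamma> s) > 0"
  shows "integral_curve_on Y \<gamma> a b"
  unfolding integral_curve_on_def
proof
  fix t assume t: "t \<in> {a..b}"
  have "continuous_on {a..b} \<gamma>"
    using filippov_velocity_continuous[OF v] ab by (auto intro: continuous_on_subset)
  then have Yc: "continuous_on {a..b} (\<lambda>s. Y (\<gamma> s))"
    by (intro continuous_on_compose2[OF cont]) auto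
  have eq: "\<gamma> a + integral {a..s} (\<lambda>s. Y (\<gamma> s)) = \<gamma> s" if s: "s \<in> {a..b}" for s
  proof -
    have eq: "Y (\<gamma> r) = g r" if "r \<in> {a..s} - {a, b}" for r
    proof -
      have "r \<in> {a<..<b}" "r \<in> {0..T}"
        using that s ab by auto
      moreover from this have "g r \<in> filippov_set X Y (\<gamma> r)"
        using v unfolding filippov_velocity_def by blast
      ultimately show ?thesis
        using outside[of r] by (simp add: filippov_set_def)
    qed
    have "(g has_integral (\<gamma> s - \<gamma> a)) {a..s}"
      using v ab s unfolding filippov_velocity_def by auto
    then have "((\<lambda>s. Y (\<gamma> s)) has_integral (\<gamma> s - \<gamma> a)) {a..s}"
      by (rule has_integral_spike_finite[of "{a, b}", rotated 2]) (simp_all only: eq finite.intros)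
    then show ?thesis by (simp add: integral_unique)
  qed
  have "((\<lambda>s. \<gamma> a + integral {a..s} (\<lambda>s. Y (\<gamma> s))) has_vector_derivative Y (\<gamma> t)) (at t within {a..b})"
    by (auto intro!: derivative_eq_intros integral_has_vector_derivative[OF Yc t])
  then show "(\<gamma> has_vector_derivative Y (\<gamma> t)) (at t within {a..b})"
    by (rule has_vector_derivative_transform[OF t, rotated]) (use eq in auto)
qed

section \<open>Scalar linear growth and zeros of continuous functions\<close>

lemma exponential_growth:
  fixes f :: "real \<Rightarrow> real"
  assumes "\<And>s. s \<in> {a..b} \<Longrightarrow> (f has_real_derivative k * f s) (at s within {a..b})"
    and s: "s \<in> {a..b}"
  shows "f s = exp (k * (s - a)) * f a"
proof -
  \<comment> \<open>Integrating factor: this product has derivative zero.\<close>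
  let ?F = "\<lambda>s. exp (- k * (s - a)) * f s"
  have "(?F has_field_derivative 0) (at s within {a..b})" if "s \<in> {a..b}" for s
    by (rule derivative_eq_intros assms(1)[OF that] refl | simp)+
  from has_field_derivative_zero_constant[of "{a..b}" ?F, OF convex_closed_interval this]
  obtain c where c: "\<And>s. s \<in> {a..b} \<Longrightarrow> ?F s = c"
    by blast
  have "exp (- (k * (s - a))) * f s = f a"
    using c[OF s] c[of a] s by simp
  then show ?thesis
    by (simp add: exp_minus divide_simps)
qed

text \<open>The zero sets on both sides of \<open>t\<close> are compact, so there is a last zero
  \<open>a\<close> before \<open>t\<close> and a first zero \<open>b\<close> after it; a change of
  sign in between would produce another zero.\<close>

lemma nonzero_gap:
  fixes f :: "real \<Rightarrow> real"
  assumes cont: "continuous_on {0..T} f" and ends: "f 0 = 0" "f T = 0"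
    and t: "t \<in> {0..T}" "\<sigma> * f t > 0"
  obtains a b where "0 \<le> a" "a < t" "t < b" "b \<le> T" "f a = 0" "f b = 0"
    "\<And>s. s \<in> {a<..<b} \<Longrightarrow> \<sigma> * f s > 0"
proof -
  have sub: "continuous_on A f" if "A \<subseteq> {0..T}" for A
    using cont that by (rule continuous_on_subset)
  have cpt: "compact {s \<in> A. f s = 0}" if "A \<subseteq> {0..T}" "compact A" for A
  proof -
    have "closed {s \<in> A. f s = 0}"
      using continuous_closed_preimage_constant[OF sub[OF that(1)] compact_imp_closed[OF that(2)]]
      by simp
    from closed_Int_compact[OF this that(2)] show ?thesis
      by (rule back_subst[of compact]) auto
  qed
  have "\<exists>a\<in>{s\<in>{0..t}. f s = 0}. \<forall>s\<in>{s\<in>{0..t}. f s = 0}. s \<le> a"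
    using ends t by (intro compact_attains_sup cpt) auto
  then obtain a where a: "a \<in> {0..t}" "f a = 0" "\<And>s. s \<in> {0..t} \<Longrightarrow> f s = 0 \<Longrightarrow> s \<le> a" by blast
  have "\<exists>b\<in>{s\<in>{t..T}. f s = 0}. \<forall>s\<in>{s\<in>{t..T}. f s = 0}. b \<le> s"
    using ends t by (intro compact_attains_inf cpt) auto
  then obtain b where b: "b \<in> {t..T}" "f b = 0" "\<And>s. s \<in> {t..T} \<Longrightarrow> f s = 0 \<Longrightarrow> b \<le> s" by blast
  have ne: "a \<noteq> t" "b \<noteq> t"
    using a b t by auto
  have nz: "f s \<noteq> 0" if "s \<in> {a<..<b}" for s
    using a(1) b(1) a(3)[of s] b(3)[of s] that by (cases "s \<le> t") auto
  have "\<sigma> * f s > 0" if s: "s \<in> {a<..<b}" for s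
  proof (rule ccontr)
    assume "\<not> \<sigma> * f s > 0"
    have "connected ((\<lambda>s. \<sigma> * f s) ` {a<..<b})"
      using a(1) b(1) by (intro connected_continuous_image continuous_intros sub) auto
    moreover have "\<sigma> * f s \<in> (\<lambda>s. \<sigma> * f s) ` {a<..<b}" "\<sigma> * f t \<in> (\<lambda>s. \<sigma> * f s) ` {a<..<b}"
      using s a(1) b(1) ne by auto
    moreover have "\<sigma> * f s \<le> 0" "0 \<le> \<sigma> * f t"
      using t(2) \<open>\<not> \<sigma> * f s > 0\<close> by auto
    ultimately have "0 \<in> (\<lambda>s. \<sigma> * f s) ` {a<..<b}"
      by (meson connectedD_interval)
    then show False
      using nz t(2) by auto
  qed
  then show ?thesis
    using that[of a b] a(1,2) b(1,2) ne by auto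
qed

section \<open>The saddle and its trajectories\<close>

definition X0 :: vfield where
  "X0 = (\<lambda>_. vector [0, 1])"

definition saddle_matrix :: "real^2^2" where
  "saddle_matrix = vector [vector [-1, 4], vector [2, 1]]"

definition Y0 :: vfield where
  "Y0 = (\<lambda>z. saddle_matrix *v z + vector [4/5, - 77/20])"

text \<open>The linear part is a left eigenvector of \<open>saddle_matrix\<close> for the eigenvalue
  3, and that of \<open>stable_coord\<close> is one for - 3; both forms vanish at the saddle point
  (9/5, 1/4).\<close>

definition unstable_coord :: "real^2 \<Rightarrow> real" where
  "unstable_coord z = z$1 + 2 * z$2 - 23/10"

definition stable_coord :: "real^2 \<Rightarrow> real" where
  "stable_coord z = z$1 - z$2 - 31/20"

text \<open>The solution of \<open>Y0\<close> through (4/5, 3/5): that point minus the saddle point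
  is split along the eigenvectors (1, 1) and (2, -1).\<close>

definition outer_arc :: "real \<Rightarrow> real^2" where
  "outer_arc t = vector [9/5, 1/4] - exp (3 * t) *\<^sub>R vector [1/10, 1/10] -
     exp (- 3 * t) *\<^sub>R vector [9/10, - 9/20]"

definition arc_time :: real where
  "arc_time = ln 9 / 3"

definition chord :: "real \<Rightarrow> real^2" where
  "chord t = vector [4/5, t - 3/5]"

definition cycle :: "(real^2) set" where
  "cycle = chord ` {0..6/5} \<union> outer_arc ` {0..arc_time}"

lemma vec2_eq_iff: "(z :: real^2) = w \<longleftrightarrow> z$1 = w$1 \<and> z$2 = w$2"
  by (simp add: vec_eq_iff forall_2)

lemma X0_nth [simp]: "X0 z $ 1 = 0" "X0 z $ 2 = 1"
  by (simp_all add: X0_def)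

lemma Y0_nth [simp]: "Y0 z $ 1 = - z$1 + 4 * z$2 + 4/5" "Y0 z $ 2 = 2 * z$1 + z$2 - 77/20"
  by (simp_all add: Y0_def saddle_matrix_def matrix_vector_mult_def sum_2)

lemma outer_arc_nth [simp]:
  "outer_arc t $ 1 = 9/5 - exp (3 * t) / 10 - 9/10 * exp (- 3 * t)"
  "outer_arc t $ 2 = 1/4 - exp (3 * t) / 10 + 9/20 * exp (- 3 * t)"
  by (simp_all add: outer_arc_def)

lemma chord_nth [simp]: "chord t $ 1 = 4/5" "chord t $ 2 = t - 3/5"
  by (simp_all add: chord_def)

lemma continuous_X0: "continuous_on A X0"
  unfolding X0_def by (intro continuous_intros)

lemma continuous_Y0: "continuous_on A Y0"
  unfolding Y0_def by (intro continuous_intros matrix_vector_mult_linear_continuous_on)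

lemma lie_h_X0: "lie_h X0 z = 2 * z$2"
  by (simp add: lie_h_eq_inner inner_vec_def sum_2)

lemma lie_h_Y0: "lie_h Y0 z = 2 * (z$1 * (- z$1 + 4 * z$2 + 4/5) + z$2 * (2 * z$1 + z$2 - 77/20))"
  by (simp add: lie_h_eq_inner inner_vec_def sum_2)

lemma X0_Y0_in_X1S1: "(X0, Y0) \<in> X1S1"
proof -
  have "eigenvalue saddle_matrix 3"
    unfolding eigenvalue_def
    by (rule exI[of _ "vector [1, 1]"])
      (simp add: vec2_eq_iff saddle_matrix_def matrix_vector_mult_def sum_2)
  moreover have "eigenvalue saddle_matrix (- 3)"
    unfolding eigenvalue_def
    by (rule exI[of _ "vector [2, -1]"])
      (simp add: vec2_eq_iff saddle_matrix_def matrix_vector_mult_def sum_2)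
  moreover have "Y0 (vector [9/5, 1/4]) = 0"
    by (simp add: vec2_eq_iff)
  ultimately have "affine_saddle Y0"
    unfolding affine_saddle_def Y0_def by (metis zero_less_numeral neg_less_0_iff_less)
  moreover have "divergence Y0 z = 0" for z
    by (simp add: Y0_def divergence_affine trace_def sum_2 saddle_matrix_def)
  moreover have "constant_field X0"
    by (auto simp: constant_field_def X0_def)
  ultimately show ?thesis
    by (simp add: X1S1_def)
qed

lemma saddle_coords:
  assumes "integral_curve_on Y0 \<gamma> a b" "s \<in> {a..b}"
  shows "unstable_coord (\<gamma> s) = exp (3 * (s - a)) * unstable_coord (\<gamma> a)"
    and "stable_coord (\<gamma> s) = exp (- 3 * (s - a)) * stable_coord (\<gamma> a)"
proof -
  have d: "((\<lambda>t. \<gamma> t $ i) has_real_derivative Y0 (\<gamma> t) $ i) (at t within {a..b})"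
    if "t \<in> {a..b}" for t i
    using assms(1) that bounded_linear.has_vector_derivative[OF bounded_linear_vec_nth]
    unfolding integral_curve_on_def has_real_derivative_iff_has_vector_derivative by blast
  show "unstable_coord (\<gamma> s) = exp (3 * (s - a)) * unstable_coord (\<gamma> a)"
    by (rule exponential_growth[OF _ assms(2)], unfold unstable_coord_def)
      (rule derivative_eq_intros d refl | assumption | simp)+
  show "stable_coord (\<gamma> s) = exp (- 3 * (s - a)) * stable_coord (\<gamma> a)"
    by (rule exponential_growth[OF _ assms(2)], unfold stable_coord_def)
      (rule derivative_eq_intros d refl | assumption | simp)+
qed

lemma saddle_first_integral:
  assumes "integral_curve_on Y0 \<gamma> a b" "s \<in> {a..b}"
  shows "unstable_coord (\<gamma> s) * stable_coord (\<gamma> s) = unstable_coord (\<gamma> a) * stable_coord (\<gamma> a)"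
  unfolding saddle_coords[OF assms] by (simp add: mult_exp_exp)

lemma saddle_coords_inject:
  assumes "unstable_coord z = unstable_coord w" "stable_coord z = stable_coord w"
  shows "z = w"
  using assms by (simp add: unstable_coord_def stable_coord_def vec2_eq_iff)

lemma outer_arc_coords:
  "unstable_coord (outer_arc t) = - 3/10 * exp (3 * t)" "stable_coord (outer_arc t) = - 27/20 * exp (- 3 * t)"
  by (simp_all add: unstable_coord_def stable_coord_def field_simps)

text \<open>Clearing denominators turns \<open>h\<close> along the arc into a quartic in
  \<open>u\<close>. The ends of the arc, at \<open>u\<close> = 1 and \<open>u\<close> = 9, account
  for two linear factors.\<close>

lemma h_outer_arc:
  fixes t :: real
  defines "u \<equiv> exp (3 * t)"
  shows "u\<^sup>2 * h (outer_arc t) = (u - 1) * (u - 9) * (u\<^sup>2 / 50 - 21/100 * u + 9/80)"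
proof -
  have u: "u > 0" "exp (- 3 * t) = 1 / u"
    by (simp_all add: u_def exp_minus field_simps)
  have "outer_arc t $ 1 = 9/5 - u / 10 - 9/10 * (1 / u)" "outer_arc t $ 2 = 1/4 - u / 10 + 9/20 * (1 / u)"
    using u by (simp_all add: u_def)
  then show ?thesis
    using u(1) by (simp only: h_def) (simp add: field_simps power2_eq_square)
qed

lemma exp_arc_time: "exp (3 * arc_time) = 9"
  by (simp add: arc_time_def)

lemma arc_time_pos: "arc_time > 0"
  by (simp add: arc_time_def)

lemma outer_arc_ends: "outer_arc 0 = vector [4/5, 3/5]" "outer_arc arc_time = vector [4/5, - 3/5]"
  using exp_arc_time by (simp_all add: vec2_eq_iff exp_minus)

lemma h_outer_arc_pos:
  assumes "t \<in> {0<..<arc_time}"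
  shows "h (outer_arc t) > 0"
proof -
  define u where "u = exp (3 * t)"
  have u: "1 < u" "u < 9"
    using assms exp_arc_time exp_less_cancel_iff[of "3 * t" "3 * arc_time"] by (auto simp: u_def)
  have neg: "(u - 1) * (u - 9) < 0"
    using u by (simp add: mult_pos_neg)
  then have "u\<^sup>2 - 10 * u + 9 < 0"
    by (simp add: algebra_simps power2_eq_square)
  \<comment> \<open>The left side is 1/50 of the preceding quadratic minus
    \<open>u / 100 + 27/400\<close>.\<close>
  then have "u\<^sup>2 / 50 - 21/100 * u + 9/80 < 0"
    using u by linarith
  then have "u\<^sup>2 * h (outer_arc t) > 0"
    using neg unfolding u_def h_outer_arc by (rule mult_neg_neg[rotated])
  then show ?thesis
    by (simp add: zero_less_mult_iff)
qed

lemma h_chord_neg: "t \<in> {0<..<6/5} \<Longrightarrow> h (chord t) < 0"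
proof -
  assume "t \<in> {0<..<6/5}"
  then have "t * (t - 6/5) < 0"
    by (simp add: mult_pos_neg)
  then show ?thesis
    by (simp add: h_def power2_eq_square algebra_simps)
qed

section \<open>Closed trajectories through crossing points\<close>

text \<open>A start on the circle makes \<open>h\<close> vanish at both ends of the time interval,
  as \<open>nonzero_gap\<close> requires.\<close>

locale crossing_loop =
  fixes T :: real and \<gamma> g :: "real \<Rightarrow> real^2"
  assumes T_pos: "0 < T"
    and velocity: "filippov_velocity X0 Y0 T \<gamma> g"
    and closed: "\<gamma> T = \<gamma> 0"
    and start: "h (\<gamma> 0) = 0"
    and crossing: "\<gamma> ` {0..T} \<inter> S1 \<subseteq> crossing_region X0 Y0"
begin

abbreviation "\<Gamma> \<equiv> \<gamma> ` {0..T}"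

lemma continuous_h_orbit: "continuous_on {0..T} (\<lambda>t. h (\<gamma> t))"
  using continuous_on_compose2[OF continuous_on_h filippov_velocity_continuous[OF velocity]] T_pos
  by auto

text \<open>\<open>lie_h X0\<close> is twice the ordinate, so at a crossing point both derivatives
  of \<open>h\<close> have the sign of the ordinate: the orbit leaves the disc in the upper half
  plane and enters it in the lower one.\<close>

lemma crossing_sign:
  assumes "t \<in> {0..T}" "h (\<gamma> t) = 0"
  shows "\<gamma> t $ 2 \<noteq> 0" "sgn (\<gamma> t $ 2) * lie_h X0 (\<gamma> t) > 0" "sgn (\<gamma> t $ 2) * lie_h Y0 (\<gamma> t) > 0"
proof -
  have "\<gamma> t \<in> crossing_region X0 Y0"
    using assms crossing by (auto simp: mem_S1_iff)
  then have *: "\<gamma> t $ 2 * lie_h Y0 (\<gamma> t) > 0"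
    by (simp add: crossing_region_def lie_h_X0 mult.commute)
  then show "\<gamma> t $ 2 \<noteq> 0" by auto
  with * show "sgn (\<gamma> t $ 2) * lie_h X0 (\<gamma> t) > 0" "sgn (\<gamma> t $ 2) * lie_h Y0 (\<gamma> t) > 0"
    by (auto simp: lie_h_X0 sgn_if zero_less_mult_iff)
qed

lemma crossing_monotone:
  assumes "t \<in> {0..T}" "h (\<gamma> t) = 0"
  obtains e where "e > 0"
    "\<And>s s'. 0 \<le> s \<Longrightarrow> s < s' \<Longrightarrow> s' \<le> T \<Longrightarrow> \<bar>s - t\<bar> < e \<Longrightarrow> \<bar>s' - t\<bar> < e \<Longrightarrow>
       sgn (\<gamma> t $ 2) * h (\<gamma> s) < sgn (\<gamma> t $ 2) * h (\<gamma> s')"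
  using filippov_velocity_crossing_monotone[OF velocity assms(1) continuous_X0 continuous_Y0
      crossing_sign(2,3)[OF assms]] by blast

text \<open>Strict monotonicity of \<open>h\<close> fixes its sign just after \<open>t\<close>. The
  gap around a time \<open>q\<close> taken in that short interval must begin exactly at
  \<open>t\<close>.\<close>

lemma gap_after:
  assumes t: "t \<in> {0..<T}" "h (\<gamma> t) = 0"
  obtains b where "t < b" "b \<le> T" "h (\<gamma> b) = 0"
    "\<And>s. s \<in> {t<..<b} \<Longrightarrow> sgn (\<gamma> t $ 2) * h (\<gamma> s) > 0"
proof -
  let ?\<sigma> = "sgn (\<gamma> t $ 2)"
  obtain e where e: "e > 0"
    "\<And>s s'. 0 \<le> s \<Longrightarrow> s < s' \<Longrightarrow> s' \<le> T \<Longrightarrow> \<bar>s - t\<bar> < e \<Longrightarrow> \<bar>s' - t\<bar> < e \<Longrightarrow>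
       ?\<sigma> * h (\<gamma> s) < ?\<sigma> * h (\<gamma> s')"
    using crossing_monotone[of t] t by auto
  have after: "?\<sigma> * h (\<gamma> s) > 0" if "t < s" "s < t + e" "s \<le> T" for s
    using e(2)[of t s] e(1) t that by auto
  define q where "q = min (t + e / 2) T"
  have q: "t < q" "q < t + e" "q \<le> T"
    using e(1) t by (auto simp: q_def min_def)
  from continuous_h_orbit obtain a b where ab: "0 \<le> a" "a < q" "q < b" "b \<le> T" "h (\<gamma> a) = 0" "h (\<gamma> b) = 0"
    "\<And>s. s \<in> {a<..<b} \<Longrightarrow> ?\<sigma> * h (\<gamma> s) > 0"
    using nonzero_gap[of T "\<lambda>t. h (\<gamma> t)" q ?\<sigma>] after[OF q] start closed q t
    by auto
  have "a \<le> t"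
    using after[of a] ab q by force
  moreover have "t \<le> a"
    using ab(7)[of t] t q ab by force
  ultimately have "a = t" by simp
  then show ?thesis
    using that[of b] ab q by auto
qed

text \<open>Mirror image of \<open>gap_after\<close>: just before the crossing \<open>h\<close> has
  the opposite sign.\<close>

lemma gap_before:
  assumes t: "t \<in> {0<..T}" "h (\<gamma> t) = 0"
  obtains a where "0 \<le> a" "a < t" "h (\<gamma> a) = 0"
    "\<And>s. s \<in> {a<..<t} \<Longrightarrow> sgn (\<gamma> t $ 2) * h (\<gamma> s) < 0"
proof -
  let ?\<sigma> = "sgn (\<gamma> t $ 2)"
  obtain e where e: "e > 0"
    "\<And>s s'. 0 \<le> s \<Longrightarrow> s < s' \<Longrightarrow> s' \<le> T \<Longrightarrow> \<bar>s - t\<bar> < e \<Longrightarrow> \<bar>s' - t\<bar> < e \<Longrightarrow>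
       ?\<sigma> * h (\<gamma> s) < ?\<sigma> * h (\<gamma> s')"
    using crossing_monotone[of t] t by auto
  have before: "- ?\<sigma> * h (\<gamma> s) > 0" if "s < t" "t - e < s" "0 \<le> s" for s
    using e(2)[of s t] e(1) t that by auto
  define q where "q = max (t - e / 2) 0"
  have q: "q < t" "t - e < q" "0 \<le> q"
    using e(1) t by (auto simp: q_def max_def)
  from continuous_h_orbit obtain a b where ab: "0 \<le> a" "a < q" "q < b" "b \<le> T" "h (\<gamma> a) = 0" "h (\<gamma> b) = 0"
    "\<And>s. s \<in> {a<..<b} \<Longrightarrow> - ?\<sigma> * h (\<gamma> s) > 0"
    using nonzero_gap[of T "\<lambda>t. h (\<gamma> t)" q "- ?\<sigma>"] before[OF q] start closed q t
    by auto
  have "t \<le> b"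
    using before[of b] ab q by force
  moreover have "b \<le> t"
    using ab(7)[of t] t q ab by force
  ultimately have "b = t" by simp
  then show ?thesis
    using that[of a] ab q by auto
qed

text \<open>The motion is vertical with unit speed. Both ends lie on the circle with the same
  abscissa, so their ordinates are equal or opposite, and equality is excluded by
  \<open>a < b\<close>.\<close>

lemma inside_gap:
  assumes ab: "0 \<le> a" "a < b" "b \<le> T" "h (\<gamma> a) = 0" "h (\<gamma> b) = 0"
    and inside: "\<And>s. s \<in> {a<..<b} \<Longrightarrow> h (\<gamma> s) < 0"
  shows "s \<in> {a..b} \<Longrightarrow> \<gamma> s $ 1 = \<gamma> a $ 1"
    and "s \<in> {a..b} \<Longrightarrow> \<gamma> s $ 2 = \<gamma> a $ 2 + (s - a)"
    and "b - a = - 2 * \<gamma> a $ 2"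
proof -
  have *: "\<gamma> s = \<gamma> a + (s - a) *\<^sub>R vector [0, 1]" if "s \<in> {a..b}" for s
    using filippov_velocity_inside[OF velocity[unfolded X0_def] ab(1) _ ab(3) inside that] ab by simp
  show 1: "\<gamma> s $ 1 = \<gamma> a $ 1" "\<gamma> s $ 2 = \<gamma> a $ 2 + (s - a)" if "s \<in> {a..b}" for s
    using *[OF that] by simp_all
  have "(\<gamma> a $ 2 + (b - a))\<^sup>2 = (\<gamma> a $ 2)\<^sup>2"
    using ab(4,5) 1[of b] ab(2) by (simp add: h_def)
  then have "\<gamma> a $ 2 + (b - a) = \<gamma> a $ 2 \<or> \<gamma> a $ 2 + (b - a) = - \<gamma> a $ 2"
    by (simp add: power2_eq_iff)
  then show "b - a = - 2 * \<gamma> a $ 2"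
    using ab(2) by auto
qed

text \<open>A wrong sign of the ordinate at an end would make \<open>h\<close> negative next to it,
  by \<open>gap_after\<close> or \<open>gap_before\<close>; the midpoint of the overlap of the two
  gaps then gives the contradiction.\<close>

lemma outside_gap:
  assumes ab: "0 \<le> a" "a < b" "b \<le> T" "h (\<gamma> a) = 0" "h (\<gamma> b) = 0"
    and outside: "\<And>s. s \<in> {a<..<b} \<Longrightarrow> h (\<gamma> s) > 0"
  shows "integral_curve_on Y0 \<gamma> a b" "\<gamma> a $ 2 > 0" "\<gamma> b $ 2 < 0"
proof -
  show "integral_curve_on Y0 \<gamma> a b"
    using ab by (intro filippov_velocity_outside[OF velocity] continuous_Y0 outside) auto
  show "\<gamma> a $ 2 > 0"
  proof (rule ccontr)
    assume "\<not> \<gamma> a $ 2 > 0"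
    then have neg: "sgn (\<gamma> a $ 2) = - 1"
      using crossing_sign(1)[of a] ab by (simp add: sgn_if)
    have "a \<in> {0..<T}"
      using ab by simp
    then obtain c where c: "a < c" "c \<le> T" "h (\<gamma> c) = 0" "\<And>s. s \<in> {a<..<c} \<Longrightarrow> sgn (\<gamma> a $ 2) * h (\<gamma> s) > 0"
      using gap_after[OF _ ab(4)] by blast
    define s where "s = (a + min b c) / 2"
    have "s \<in> {a<..<c}" "s \<in> {a<..<b}"
      using c(1) ab(2) by (auto simp: s_def min_def)
    then show False
      using c(4)[of s] outside[of s] neg by simp
  qed
  show "\<gamma> b $ 2 < 0"
  proof (rule ccontr)
    assume "\<not> \<gamma> b $ 2 < 0"
    then have neg: "sgn (\<gamma> b $ 2) = 1"
      using crossing_sign(1)[of b] ab by (simp add: sgn_if)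
    have "b \<in> {0<..T}"
      using ab by simp
    then obtain c where c: "0 \<le> c" "c < b" "h (\<gamma> c) = 0" "\<And>s. s \<in> {c<..<b} \<Longrightarrow> sgn (\<gamma> b $ 2) * h (\<gamma> s) < 0"
      using gap_before[OF _ ab(5)] by blast
    define s where "s = (max a c + b) / 2"
    have "s \<in> {c<..<b}" "s \<in> {a<..<b}"
      using c(2) ab(2) by (auto simp: s_def max_def)
    then show False
      using c(4)[of s] outside[of s] neg by simp
  qed
qed

section \<open>Consecutive crossings of the circle\<close>

text \<open>The times 0 and \<open>T\<close> give the same point, so a time can be chosen that
  leaves room for a gap after it; \<open>orbit_time_pos\<close> leaves room before it.\<close>

lemma orbit_time:
  assumes "z \<in> \<Gamma>"
  obtains t where "t \<in> {0..<T}" "\<gamma> t = z"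
proof -
  obtain t where "t \<in> {0..T}" "\<gamma> t = z"
    using assms by blast
  then show ?thesis
    using that[of t] that[of 0] closed T_pos by (cases "t = T") auto
qed

lemma orbit_time_pos:
  assumes "z \<in> \<Gamma>"
  obtains t where "t \<in> {0<..T}" "\<gamma> t = z"
proof -
  obtain t where "t \<in> {0..T}" "\<gamma> t = z"
    using assms by blast
  then show ?thesis
    using that[of t] that[of T] closed T_pos by (cases "t = 0") auto
qed

lemma next_upper:
  assumes "z \<in> \<Gamma>" "h z = 0" "z$2 < 0"
  obtains w where "w \<in> \<Gamma>" "h w = 0" "w$1 = z$1" "w$2 = - z$2"
proof -
  obtain t where t: "t \<in> {0..<T}" "\<gamma> t = z"
    using orbit_time[OF assms(1)] by blast
  obtain b where b: "t < b" "b \<le> T" "h (\<gamma> b) = 0" "\<And>s. s \<in> {t<..<b} \<Longrightarrow> sgn (\<gamma> t $ 2) * h (\<gamma> s) > 0"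
    using gap_after[of t] t assms by auto
  have "h (\<gamma> s) < 0" if "s \<in> {t<..<b}" for s
    using b(4)[OF that] t assms by simp
  note gap = inside_gap[OF _ b(1,2) _ b(3) this]
  show ?thesis
    using that[of "\<gamma> b"] gap(1,2)[of b] gap(3) b t assms by auto
qed

lemma next_lower:
  assumes "z \<in> \<Gamma>" "h z = 0" "z$2 > 0"
  obtains w where "w \<in> \<Gamma>" "h w = 0" "w$2 < 0"
    "unstable_coord w * stable_coord w = unstable_coord z * stable_coord z"
proof -
  obtain t where t: "t \<in> {0..<T}" "\<gamma> t = z"
    using orbit_time[OF assms(1)] by blast
  obtain b where b: "t < b" "b \<le> T" "h (\<gamma> b) = 0" "\<And>s. s \<in> {t<..<b} \<Longrightarrow> sgn (\<gamma> t $ 2) * h (\<gamma> s) > 0"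
    using gap_after[of t] t assms by auto
  have "h (\<gamma> s) > 0" if "s \<in> {t<..<b}" for s
    using b(4)[OF that] t assms by simp
  note gap = outside_gap[OF _ b(1,2) _ b(3) this]
  have "integral_curve_on Y0 \<gamma> t b" "\<gamma> b $ 2 < 0"
    using gap t assms by auto
  moreover have "unstable_coord (\<gamma> b) * stable_coord (\<gamma> b) = unstable_coord z * stable_coord z"
    using saddle_first_integral[of \<gamma> t b b] b(1) t(2) \<open>integral_curve_on Y0 \<gamma> t b\<close>
    by simp
  ultimately show ?thesis
    using that[of "\<gamma> b"] b t by auto
qed

lemma previous_lower:
  assumes "z \<in> \<Gamma>" "h z = 0" "z$2 > 0"
  obtains w where "w \<in> \<Gamma>" "h w = 0" "w$1 = z$1" "w$2 = - z$2"
proof -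
  obtain t where t: "t \<in> {0<..T}" "\<gamma> t = z"
    using orbit_time_pos[OF assms(1)] by blast
  obtain a where a: "0 \<le> a" "a < t" "h (\<gamma> a) = 0" "\<And>s. s \<in> {a<..<t} \<Longrightarrow> sgn (\<gamma> t $ 2) * h (\<gamma> s) < 0"
    using gap_before[of t] t assms by auto
  have "h (\<gamma> s) < 0" if "s \<in> {a<..<t}" for s
    using a(4)[OF that] t assms by simp
  note gap = inside_gap[OF a(1,2) _ a(3) _ this]
  show ?thesis
    using that[of "\<gamma> a"] gap(1,2)[of t] gap(3) a t assms by auto
qed

end

section \<open>The return map between entry points\<close>

lemma first_integral_on_S1:
  assumes "h z = 0"
  shows "unstable_coord z * stable_coord z =
    3 * (z$1)\<^sup>2 - 77/20 * z$1 + (z$1 - 4/5) * z$2 + 313/200"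
proof -
  have "(z$2)\<^sup>2 = 1 - (z$1)\<^sup>2"
    using assms by (simp add: h_def)
  moreover have "unstable_coord z * stable_coord z =
      (z$1)\<^sup>2 + z$1 * z$2 - 2 * (z$2)\<^sup>2 - 77/20 * z$1 - 4/5 * z$2 + 713/200"
    by (simp add: unstable_coord_def stable_coord_def field_simps power2_eq_square)
  ultimately show ?thesis
    by (simp add: algebra_simps)
qed

text \<open>The points \<open>(x, - y)\<close> and \<open>(x', - y')\<close> are consecutive entries into the disc: the chord leads
  from \<open>(x, - y)\<close> to \<open>(x, y)\<close>, and \<open>eq\<close> says that the first integral agrees at \<open>(x, y)\<close> and \<open>(x', - y')\<close>.\<close>

lemma return_map_repels:
  fixes x y x' y' :: real
  assumes circle: "x\<^sup>2 + y\<^sup>2 = 1" "x'\<^sup>2 + y'\<^sup>2 = 1"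
    and y: "0 < y" "0 < y'" and x: "39/50 < x" "39/50 < x'"
    and eq: "3 * x'\<^sup>2 - 77/20 * x' - (x' - 4/5) * y' = 3 * x\<^sup>2 - 77/20 * x + (x - 4/5) * y"
  shows "4/5 < x \<Longrightarrow> x < x'" and "x < 4/5 \<Longrightarrow> x' < x"
proof -
  \<comment> \<open>The bound 39/50 yields two constants: \<open>y'\<close> is at most 63/100, and
    \<open>3 * (x + x') - 77/20\<close> is at least 83/100. Since 83 exceeds 63, the first summand
    of \<open>eq'\<close> dominates the last.\<close>
  have "(39/50)\<^sup>2 \<le> x'\<^sup>2"
    using x by (intro power_mono) auto
  then have "y'\<^sup>2 \<le> (63/100)\<^sup>2"
    using circle(2) by (simp add: power2_eq_square)
  then have y': "y' \<le> 63/100"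
    by (rule power2_le_imp_le) simp
  have eq': "(x - x') * (3 * (x + x') - 77/20) + (x - 4/5) * y + (x' - 4/5) * y' = 0"
    "(x' - x) * (3 * (x + x') - 77/20) + (4/5 - x) * y + (4/5 - x') * y' = 0"
    using eq by (simp_all add: algebra_simps power2_eq_square diff_divide_distrib)
  \<comment> \<open>The nonlinear products become variables, which leaves a linear
    contradiction.\<close>
  have contr: False if "p \<le> q" "0 < r" "q + r + s = 0" "- s \<le> p" for p q r s :: real
    using that by linarith
  show "x < x'" if "4/5 < x"
  proof (rule ccontr)
    assume "\<not> x < x'"
    then have 1: "(x - x') * (83/100) \<le> (x - x') * (3 * (x + x') - 77/20)"
      using x by (intro mult_left_mono) auto
    have 2: "0 < (x - 4/5) * y"
      using that y by simp
    \<comment> \<open>Either the left side is nonpositive and the right side nonnegative, or both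
      factors on the left are bounded by those on the right.\<close>
    have "(4/5 - x') * y' \<le> (x - x') * (83/100)"
    proof (cases "4/5 \<le> x'")
      case True
      then have "(4/5 - x') * y' \<le> 0"
        using y by (intro mult_nonpos_nonneg) auto
      then show ?thesis
        using \<open>\<not> x < x'\<close> by (simp add: algebra_simps)
    next
      case False
      then show ?thesis
        using that y y' by (intro mult_mono) auto
    qed
    then have "- ((x' - 4/5) * y') \<le> (x - x') * (83/100)"
      by (simp flip: mult_minus_left)
    then show False
      by (rule contr[OF 1 2 eq'(1)])
  qed
  show "x' < x" if "x < 4/5"
  proof (rule ccontr)
    assume "\<not> x' < x"
    then have 1: "(x' - x) * (83/100) \<le> (x' - x) * (3 * (x + x') - 77/20)"
      using x by (intro mult_left_mono) auto
    have 2: "0 < (4/5 - x) * y"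
      using that y by simp
    have "(x' - 4/5) * y' \<le> (x' - x) * (83/100)"
    proof (cases "x' \<le> 4/5")
      case True
      then have "(x' - 4/5) * y' \<le> 0"
        using y by (intro mult_nonpos_nonneg) auto
      then show ?thesis
        using \<open>\<not> x' < x\<close> by (simp add: algebra_simps)
    next
      case False
      then show ?thesis
        using that y y' by (intro mult_mono) auto
    qed
    then have "- ((4/5 - x') * y') \<le> (x' - x) * (83/100)"
      by (simp flip: mult_minus_left)
    then show False
      by (rule contr[OF 1 2 eq'(2)])
  qed
qed

context crossing_loop
begin

text \<open>One full turn, chord and then outer arc, written in the form that
  \<open>return_map_repels\<close> expects. The exit point \<open>m\<close> is kept for counting
  points on the circle.\<close>

lemma return_to_lower:
  assumes "z \<in> \<Gamma>" "h z = 0" "z$2 < 0"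
  obtains m w where "m \<in> \<Gamma>" "h m = 0" "m$2 > 0" "w \<in> \<Gamma>" "h w = 0" "w$2 < 0"
    "3 * (w$1)\<^sup>2 - 77/20 * w$1 - (w$1 - 4/5) * (- w$2) =
     3 * (z$1)\<^sup>2 - 77/20 * z$1 + (z$1 - 4/5) * (- z$2)"
proof -
  obtain m where m: "m \<in> \<Gamma>" "h m = 0" "m$1 = z$1" "m$2 = - z$2"
    using next_upper[OF assms] by blast
  then obtain w where w: "w \<in> \<Gamma>" "h w = 0" "w$2 < 0"
    "unstable_coord w * stable_coord w = unstable_coord m * stable_coord m"
    using next_lower[of m] assms(3) by auto
  show ?thesis
    using that[OF m(1,2) _ w(1-3)] w(4) m(3,4) assms(3)
    unfolding first_integral_on_S1[OF w(2)] first_integral_on_S1[OF m(2)] by simp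
qed

text \<open>With only two points on the circle, one of them the exit point, an entry point must
  return to itself. Otherwise the compact set of entry points has extreme abscissas, and repulsion
  from 4/5 forces both to be 4/5.\<close>

lemma lower_point_eq:
  assumes unique: "(\<forall>z \<in> \<Gamma> \<inter> S1. z$1 > 39/50) \<or> card (\<Gamma> \<inter> S1) = 2"
    and z: "z \<in> \<Gamma>" "h z = 0" "z$2 < 0"
  shows "z = chord 0"
proof -
  have x: "z$1 = 4/5"
  proof (cases "card (\<Gamma> \<inter> S1) = 2")
    case True
    obtain m w where m: "m \<in> \<Gamma>" "h m = 0" "m$2 > 0" and w: "w \<in> \<Gamma>" "h w = 0" "w$2 < 0"
      and eq: "3 * (w$1)\<^sup>2 - 77/20 * w$1 - (w$1 - 4/5) * (- w$2) =
        3 * (z$1)\<^sup>2 - 77/20 * z$1 + (z$1 - 4/5) * (- z$2)"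
      using return_to_lower[OF z] by metis
    have "w = z"
    proof (rule ccontr)
      assume "w \<noteq> z"
      moreover have "z \<noteq> m" "w \<noteq> m"
        using z m w by auto
      ultimately have "card {z, m, w} = 3"
        by simp
      moreover have "{z, m, w} \<subseteq> \<Gamma> \<inter> S1"
        using z m w by (auto simp: mem_S1_iff)
      moreover have "finite (\<Gamma> \<inter> S1)"
        by (rule card_ge_0_finite) (simp add: True)
      ultimately have "3 \<le> card (\<Gamma> \<inter> S1)"
        using card_mono by metis
      then show False
        using True by simp
    qed
    \<comment> \<open>For \<open>w = z\<close> the even terms cancel and only the term odd in the
      ordinate survives.\<close>
    with eq have "(z$1 - 4/5) * z$2 = 0"
      by (simp add: algebra_simps)
    then show ?thesis
      using z by auto
  next
    case False
    then have big: "w$1 > 39/50" if "w \<in> \<Gamma>" "h w = 0" for w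
      using unique that by (auto simp: mem_S1_iff)
    \<comment> \<open>The weak inequality makes \<open>L\<close> closed; ordinate 0 is then excluded
      by \<open>crossing_sign\<close>.\<close>
    define L where "L = \<Gamma> \<inter> {w. h w = 0} \<inter> {w. w$2 \<le> 0}"
    have "compact \<Gamma>"
      using filippov_velocity_continuous[OF velocity] T_pos
      by (intro compact_continuous_image) auto
    then have "compact L"
      unfolding L_def
      by (intro compact_Int_closed closed_Collect_eq closed_Collect_le continuous_on_h continuous_intros)
    have L: "w \<in> \<Gamma>" "h w = 0" "w$2 < 0" if "w \<in> L" for w
    proof -
      show w: "w \<in> \<Gamma>" "h w = 0"
        using that by (simp_all add: L_def)
      then have "w$2 \<noteq> 0"
        using crossing_sign(1) by blast
      then show "w$2 < 0"
        using that by (simp add: L_def)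
    qed
    have step: "\<exists>v\<in>L. (4/5 < w$1 \<longrightarrow> w$1 < v$1) \<and> (w$1 < 4/5 \<longrightarrow> v$1 < w$1)" if wL: "w \<in> L" for w
    proof -
      obtain v where v: "v \<in> \<Gamma>" "h v = 0" "v$2 < 0"
        and eq: "3 * (v$1)\<^sup>2 - 77/20 * v$1 - (v$1 - 4/5) * (- v$2) =
          3 * (w$1)\<^sup>2 - 77/20 * w$1 + (w$1 - 4/5) * (- w$2)"
        using return_to_lower[OF L[OF wL]] by metis
      have "4/5 < w$1 \<Longrightarrow> w$1 < v$1" "w$1 < 4/5 \<Longrightarrow> v$1 < w$1"
        by (rule return_map_repels[OF _ _ _ _ _ _ eq];
            use L[OF wL] v big in \<open>simp add: h_def\<close>)+
      then show ?thesis
        using v by (auto simp: L_def)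
    qed
    have ne: "L \<noteq> {}"
      using z by (auto simp: L_def)
    have cont: "continuous_on L (\<lambda>w. w$1)"
      by (intro continuous_intros)
    obtain p where p: "p \<in> L" "\<And>w. w \<in> L \<Longrightarrow> w$1 \<le> p$1"
      using continuous_attains_sup[OF \<open>compact L\<close> ne cont] by blast
    obtain q where q: "q \<in> L" "\<And>w. w \<in> L \<Longrightarrow> q$1 \<le> w$1"
      using continuous_attains_inf[OF \<open>compact L\<close> ne cont] by blast
    \<comment> \<open>Right of 4/5, the successor of the rightmost entry point would lie still
      further right; the leftmost one is treated symmetrically.\<close>
    have "p$1 \<le> 4/5"
      using step[OF p(1)] p(2) by (meson linorder_not_less)
    moreover have "4/5 \<le> q$1"
      using step[OF q(1)] q(2) by (meson linorder_not_less)
    moreover have "q$1 \<le> z$1" "z$1 \<le> p$1"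
      using p(2) q(2) z by (auto simp: L_def)
    ultimately show ?thesis
      by linarith
  qed
  have "(z$2)\<^sup>2 = 1 - (z$1)\<^sup>2"
    using z by (simp add: h_def)
  then have "(z$2)\<^sup>2 = (3/5)\<^sup>2"
    by (simp add: x power2_eq_square)
  then have "z$2 = - 3/5"
    using z by (auto simp: power2_eq_iff)
  then show ?thesis
    using x by (simp add: vec2_eq_iff)
qed

section \<open>Identification of the orbit with the cycle\<close>

lemma inside_gap_chord:
  assumes ab: "0 \<le> a" "a < b" "b \<le> T" "h (\<gamma> a) = 0" "h (\<gamma> b) = 0"
    and inside: "\<And>s. s \<in> {a<..<b} \<Longrightarrow> h (\<gamma> s) < 0" and start: "\<gamma> a = chord 0"
  shows "b = a + 6/5" and "s \<in> {a..b} \<Longrightarrow> \<gamma> s = chord (s - a)"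
  using inside_gap[OF ab inside] start by (auto simp: vec2_eq_iff)

text \<open>The two saddle coordinates determine the solution. The gap cannot end earlier, as
  \<open>h\<close> is positive along the open arc, nor later, as \<open>h\<close> vanishes at
  \<open>arc_time\<close>.\<close>

lemma outside_gap_arc:
  assumes ab: "0 \<le> a" "a < b" "b \<le> T" "h (\<gamma> a) = 0" "h (\<gamma> b) = 0"
    and outside: "\<And>s. s \<in> {a<..<b} \<Longrightarrow> h (\<gamma> s) > 0" and start: "\<gamma> a = outer_arc 0"
  shows "b = a + arc_time" and "s \<in> {a..b} \<Longrightarrow> \<gamma> s = outer_arc (s - a)"
proof -
  show *: "\<gamma> s = outer_arc (s - a)" if "s \<in> {a..b}" for s
    using saddle_coords[OF outside_gap(1)[OF ab outside] that] start
    by (intro saddle_coords_inject) (simp_all add: outer_arc_coords)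
  have "\<not> b - a < arc_time"
    using h_outer_arc_pos[of "b - a"] ab(2,5) *[of b] by auto
  moreover have "\<not> arc_time < b - a"
  proof
    assume "arc_time < b - a"
    then have "h (outer_arc arc_time) > 0"
      using outside[of "a + arc_time"] *[of "a + arc_time"] arc_time_pos by simp
    then show False
      by (simp add: outer_arc_ends h_def power2_eq_square)
  qed
  ultimately show "b = a + arc_time" by linarith
qed

text \<open>Every point off the circle lies in a gap that starts at the only entry point or the only
  exit point, hence on the chord or the arc. Conversely, the gaps after these points sweep out the
  whole chord and the whole arc.\<close>

lemma orbit_eq_cycle:
  assumes unique: "(\<forall>z \<in> \<Gamma> \<inter> S1. z$1 > 39/50) \<or> card (\<Gamma> \<inter> S1) = 2"
  shows "\<Gamma> = cycle"
proof
  have lower: "z = chord 0" if "z \<in> \<Gamma>" "h z = 0" "z$2 < 0" for z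
    using lower_point_eq[OF unique that] .
  have upper: "z = outer_arc 0" if z: "z \<in> \<Gamma>" "h z = 0" "z$2 > 0" for z
  proof -
    obtain w where "w \<in> \<Gamma>" "h w = 0" "w$1 = z$1" "w$2 = - z$2"
      using previous_lower[OF z] by blast
    then show ?thesis
      using lower[of w] z by (simp add: vec2_eq_iff)
  qed
  have sign: "z$2 \<noteq> 0" if "z \<in> \<Gamma>" "h z = 0" for z
    using that crossing_sign(1) by blast
  have ends: "outer_arc 0 \<in> cycle" "chord 0 \<in> cycle"
    using arc_time_pos by (auto simp: cycle_def)
  show "\<Gamma> \<subseteq> cycle"
  proof
    fix z assume z: "z \<in> \<Gamma>"
    then obtain t where t: "t \<in> {0..T}" "z = \<gamma> t" by blast
    show "z \<in> cycle"
    proof (cases "h z = 0")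
      case True
      then show ?thesis
        using sign[OF z] upper[OF z] lower[OF z] ends by force
    next
      case False
      have "h (\<gamma> T) = 0"
        using start closed by simp
      moreover have "sgn (h z) * h (\<gamma> t) > 0"
        using False t by (simp add: sgn_if)
      ultimately obtain a b where ab: "0 \<le> a" "a < t" "t < b" "b \<le> T" "h (\<gamma> a) = 0" "h (\<gamma> b) = 0"
        "\<And>s. s \<in> {a<..<b} \<Longrightarrow> sgn (h z) * h (\<gamma> s) > 0"
        using nonzero_gap[OF continuous_h_orbit start _ t(1)] by blast
      have aG: "\<gamma> a \<in> \<Gamma>" "a < b"
        using ab by auto
      show ?thesis
      proof (cases "h z < 0")
        case True
        then have neg: "\<And>s. s \<in> {a<..<b} \<Longrightarrow> h (\<gamma> s) < 0"
          using ab(7) by force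
        have "\<gamma> a $ 2 < 0"
          using inside_gap(3)[OF ab(1) aG(2) ab(4-6) neg] aG(2) by auto
        note gap = inside_gap_chord[OF ab(1) aG(2) ab(4-6) neg lower[OF aG(1) ab(5) this]]
        have "z = chord (t - a)" "t - a \<in> {0..6/5}"
          using gap(2)[of t] gap(1) ab t by auto
        then show ?thesis
          by (auto simp: cycle_def)
      next
        case False
        then have pos: "\<And>s. s \<in> {a<..<b} \<Longrightarrow> h (\<gamma> s) > 0"
          using ab(7) \<open>h z \<noteq> 0\<close> by force
        have "\<gamma> a $ 2 > 0"
          using outside_gap(2)[OF ab(1) aG(2) ab(4-6) pos] .
        note gap = outside_gap_arc[OF ab(1) aG(2) ab(4-6) pos upper[OF aG(1) ab(5) this]]
        have "z = outer_arc (t - a)" "t - a \<in> {0..arc_time}"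
          using gap(2)[of t] gap(1) ab t by auto
        then show ?thesis
          by (auto simp: cycle_def)
      qed
    qed
  qed
  \<comment> \<open>The initial point is on the circle: either it is an entry point, or the outer
    arc from it leads to one.\<close>
  have chord0: "chord 0 \<in> \<Gamma>"
  proof -
    have 0: "\<gamma> 0 \<in> \<Gamma>"
      using T_pos by auto
    obtain z where "z \<in> \<Gamma>" "h z = 0" "z$2 < 0"
    proof (cases "\<gamma> 0 $ 2 < 0")
      case False
      then have "\<gamma> 0 $ 2 > 0"
        using sign[OF 0 start] by simp
      then show ?thesis
        using next_lower[OF 0 start] that by blast
    qed (use 0 start that in blast)
    then show ?thesis
      using lower by metis
  qed
  have chord_sub: "chord ` {0..6/5} \<subseteq> \<Gamma>"
  proof -
    obtain t where t: "t \<in> {0..<T}" "\<gamma> t = chord 0"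
      using orbit_time[OF chord0] by blast
    have ht: "h (\<gamma> t) = 0"
      unfolding t(2) by (simp add: h_def power2_eq_square)
    obtain b where b: "t < b" "b \<le> T" "h (\<gamma> b) = 0" "\<And>s. s \<in> {t<..<b} \<Longrightarrow> sgn (\<gamma> t $ 2) * h (\<gamma> s) > 0"
      using gap_after[OF t(1) ht] by blast
    have "h (\<gamma> s) < 0" if "s \<in> {t<..<b}" for s
      using b(4)[OF that] t by simp
    note gap = inside_gap_chord[OF _ b(1,2) ht b(3) this t(2)]
    show ?thesis
    proof
      fix z assume "z \<in> chord ` {0..6/5}"
      then obtain s where s: "s \<in> {0..6/5}" "z = chord s" by blast
      then have "t + s \<in> {t..b}" "t + s \<in> {0..T}"
        using gap(1) t b by auto
      then show "z \<in> \<Gamma>"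
        using gap(2)[of "t + s"] s t by (auto intro!: image_eqI[of _ _ "t + s"])
    qed
  qed
  have "outer_arc ` {0..arc_time} \<subseteq> \<Gamma>"
  proof -
    have "chord (6/5) = outer_arc 0"
      by (simp add: vec2_eq_iff)
    moreover have "chord (6/5) \<in> \<Gamma>"
      using chord_sub by (rule subsetD) simp
    ultimately have "outer_arc 0 \<in> \<Gamma>"
      by simp
    then obtain t where t: "t \<in> {0..<T}" "\<gamma> t = outer_arc 0"
      using orbit_time by blast
    have ht: "h (\<gamma> t) = 0"
      unfolding t(2) by (simp add: h_def power2_eq_square)
    obtain b where b: "t < b" "b \<le> T" "h (\<gamma> b) = 0" "\<And>s. s \<in> {t<..<b} \<Longrightarrow> sgn (\<gamma> t $ 2) * h (\<gamma> s) > 0"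
      using gap_after[OF t(1) ht] by blast
    have "h (\<gamma> s) > 0" if "s \<in> {t<..<b}" for s
      using b(4)[OF that] t by simp
    note gap = outside_gap_arc[OF _ b(1,2) ht b(3) this t(2)]
    show ?thesis
    proof
      fix z assume "z \<in> outer_arc ` {0..arc_time}"
      then obtain s where s: "s \<in> {0..arc_time}" "z = outer_arc s" by blast
      then have "t + s \<in> {t..b}" "t + s \<in> {0..T}"
        using gap(1) t b by auto
      then show "z \<in> \<Gamma>"
        using gap(2)[of "t + s"] s t by (auto intro!: image_eqI[of _ _ "t + s"])
    qed
  qed
  with chord_sub show "cycle \<subseteq> \<Gamma>"
    by (simp add: cycle_def)
qed

end

section \<open>Arbitrary closed trajectories\<close>

text \<open>Otherwise \<open>h\<close> keeps one sign along the orbit. Inside, the constant upward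
  motion cannot close up; outside, the exponential factors force both saddle coordinates to be 0, so
  the trajectory rests at the saddle.\<close>

lemma closed_trajectory_meets_S1:
  assumes ct: "closed_trajectory X0 Y0 T \<gamma>"
  obtains t where "t \<in> {0..T}" "h (\<gamma> t) = 0"
proof (rule ccontr)
  assume "\<not> thesis"
  then have nz: "h (\<gamma> t) \<noteq> 0" if "t \<in> {0..T}" for t
    using that \<open>\<And>t. t \<in> {0..T} \<Longrightarrow> h (\<gamma> t) = 0 \<Longrightarrow> thesis\<close> by blast
  have T: "0 < T" "\<gamma> T = \<gamma> 0"
    using ct by (auto simp: closed_trajectory_def)
  obtain g where v: "filippov_velocity X0 Y0 T \<gamma> g"
    using ct filippov_trajectory_imp_velocity unfolding closed_trajectory_def by blast
  have "continuous_on {0..T} (\<lambda>t. h (\<gamma> t))"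
    using continuous_on_compose2[OF continuous_on_h filippov_velocity_continuous[OF v]] T by auto
  then have "connected ((\<lambda>t. h (\<gamma> t)) ` {0..T})"
    by (rule connected_continuous_image) simp
  then have conn: "h (\<gamma> t) > 0" if "h (\<gamma> s) \<ge> 0" "s \<in> {0..T}" "t \<in> {0..T}" for s t
    using connectedD_interval[of _ "h (\<gamma> t)" "h (\<gamma> s)" 0] that nz
    by (metis (no_types, lifting) imageE imageI linorder_not_less)
  show False
  proof (cases "h (\<gamma> 0) < 0")
    case True
    have "h (\<gamma> s) < 0" if "s \<in> {0<..<T}" for s
      using conn[of s 0] True that T by force
    then have "\<gamma> T = \<gamma> 0 + (T - 0) *\<^sub>R vector [0, 1]"
      using T by (intro filippov_velocity_inside[OF v[unfolded X0_def], of 0 T]) auto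
    then have "(T *\<^sub>R (vector [0, 1] :: real^2)) $ 2 = 0"
      using T by simp
    then show False
      using T by simp
  next
    case False
    have "h (\<gamma> s) > 0" if "s \<in> {0<..<T}" for s
      using conn[of 0 s] False that by force
    then have ic: "integral_curve_on Y0 \<gamma> 0 T"
      using T by (intro filippov_velocity_outside[OF v] continuous_Y0) auto
    have "exp (3 * T) \<noteq> 1" "exp (- 3 * T) \<noteq> 1"
      using T by simp_all
    then have "unstable_coord (\<gamma> 0) = 0" "stable_coord (\<gamma> 0) = 0"
      using saddle_coords[OF ic, of T] T by auto
    then have "\<gamma> t = \<gamma> 0" if "t \<in> {0..T}" for t
      using saddle_coords[OF ic that] by (intro saddle_coords_inject) simp_all
    then show False
      using ct unfolding closed_trajectory_def by blast
  qed
qed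

text \<open>Rotating the start onto the circle reduces this to \<open>crossing_loop\<close>. The
  first alternative of \<open>unique\<close> serves isolation of the cycle, the second its
  uniqueness.\<close>

lemma closed_trajectory_eq_cycle:
  assumes ct: "closed_trajectory X0 Y0 T \<gamma>"
    and crossing: "\<gamma> ` {0..T} \<inter> S1 \<subseteq> crossing_region X0 Y0"
    and unique: "(\<forall>z \<in> \<gamma> ` {0..T} \<inter> S1. z$1 > 39/50) \<or> card (\<gamma> ` {0..T} \<inter> S1) = 2"
  shows "\<gamma> ` {0..T} = cycle"
proof -
  have T: "0 < T" "\<gamma> T = \<gamma> 0"
    using ct by (auto simp: closed_trajectory_def)
  obtain g where v: "filippov_velocity X0 Y0 T \<gamma> g"
    using ct filippov_trajectory_imp_velocity unfolding closed_trajectory_def by blast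
  obtain r where r: "r \<in> {0..T}" "h (\<gamma> r) = 0"
    using closed_trajectory_meets_S1[OF ct] by blast
  obtain \<gamma>' g' where rot: "filippov_velocity X0 Y0 T \<gamma>' g'" "\<gamma>' 0 = \<gamma> r" "\<gamma>' T = \<gamma> r"
    "\<gamma>' ` {0..T} = \<gamma> ` {0..T}"
    using filippov_velocity_rotate[OF v T(2) r(1)] by blast
  interpret crossing_loop T \<gamma>' g'
    using T rot r crossing by unfold_locales auto
  show ?thesis
    using orbit_eq_cycle unique rot(4) by simp
qed

section \<open>The cycle\<close>

lemma integral_curve_on_subset:
  assumes "integral_curve_on F \<gamma> a b" "{c..d} \<subseteq> {a..b}"
  shows "integral_curve_on F \<gamma> c d"
  unfolding integral_curve_on_def
proof
  fix t assume t: "t \<in> {c..d}"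
  then have "(\<gamma> has_vector_derivative F (\<gamma> t)) (at t within {a..b})"
    using assms unfolding integral_curve_on_def by blast
  then show "(\<gamma> has_vector_derivative F (\<gamma> t)) (at t within {c..d})"
    using assms(2) by (rule has_vector_derivative_within_subset)
qed

lemma integral_curve_has_integral:
  assumes "integral_curve_on F \<gamma> a b" "a \<le> b"
  shows "((\<lambda>t. F (\<gamma> t)) has_integral (\<gamma> b - \<gamma> a)) {a..b}"
proof (rule fundamental_theorem_of_calculus[OF assms(2)])
  fix t assume "t \<in> {a..b}"
  then show "(\<gamma> has_vector_derivative F (\<gamma> t)) (at t within {a..b})"
    using assms(1) unfolding integral_curve_on_def by blast
qed

text \<open>Where an arc touches the circle, the Filippov segment contains the value of either
  field, so the velocities of the two arcs can simply be joined.\<close>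

lemma filippov_trajectory_of_arcs:
  assumes XY: "continuous_on UNIV X" "continuous_on UNIV Y"
    and a: "0 \<le> a" "a \<le> T"
    and X: "integral_curve_on X \<gamma> 0 a" "\<And>t. t \<in> {0..a} \<Longrightarrow> h (\<gamma> t) \<le> 0"
    and Y: "integral_curve_on Y \<gamma> a T" "\<And>t. t \<in> {a..T} \<Longrightarrow> h (\<gamma> t) \<ge> 0"
  shows "filippov_trajectory X Y T \<gamma>"
proof -
  define g where "g = (\<lambda>t. if t \<le> a then X (\<gamma> t) else Y (\<gamma> t))"
  have cont: "continuous_on {c..d} (\<lambda>t. F (\<gamma> t))"
    if "integral_curve_on F \<gamma> c d" "continuous_on UNIV F" for F c d
  proof -
    have "continuous_on {c..d} \<gamma>"
      using that(1) unfolding integral_curve_on_def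
      by (meson continuous_on_eq_continuous_within has_vector_derivative_continuous)
    then show ?thesis
      by (intro continuous_on_compose2[OF that(2)]) auto
  qed
  have "g absolutely_integrable_on {0..a}"
    by (rule absolutely_integrable_spike[OF absolutely_integrable_continuous_real[OF cont[OF X(1) XY(1)]],
          of "{}"]) (auto simp: g_def)
  moreover have "g absolutely_integrable_on {a..T}"
    \<comment> \<open>At \<open>a\<close> the function \<open>g\<close> has the value of
      \<open>X\<close>, hence the exceptional set.\<close>
    by (rule absolutely_integrable_spike[OF absolutely_integrable_continuous_real[OF cont[OF Y(1) XY(2)]],
          of "{a}"]) (auto simp: g_def)
  ultimately have "g absolutely_integrable_on ({0..a} \<union> {a..T})"
    by (rule set_integrable_Un) auto
  moreover have "{0..a} \<union> {a..T} = {0..T}"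
    using a by auto
  ultimately have "g absolutely_integrable_on {0..T}"
    by simp
  moreover have "g t \<in> filippov_set X Y (\<gamma> t)" if "t \<in> {0..T}" for t
    using X(2)[of t] Y(2)[of t] that by (auto simp: g_def filippov_set_def hull_inc)
  moreover have "\<gamma> t = \<gamma> 0 + integral {0..t} g" if "t \<in> {0..T}" for t
  proof -
    have 1: "(g has_integral (\<gamma> s - \<gamma> 0)) {0..s}" if s: "s \<in> {0..a}" for s
    proof (rule has_integral_eq)
      show "((\<lambda>t. X (\<gamma> t)) has_integral (\<gamma> s - \<gamma> 0)) {0..s}"
        using s by (intro integral_curve_has_integral integral_curve_on_subset[OF X(1)]) auto
    qed (use s in \<open>auto simp: g_def\<close>)
    have 2: "(g has_integral (\<gamma> s - \<gamma> a)) {a..s}" if s: "s \<in> {a..T}" for s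
    proof (rule has_integral_spike_finite[of "{a}"])
      show "((\<lambda>t. Y (\<gamma> t)) has_integral (\<gamma> s - \<gamma> a)) {a..s}"
        using s by (intro integral_curve_has_integral integral_curve_on_subset[OF Y(1)]) auto
    qed (auto simp: g_def)
    have "(g has_integral (\<gamma> t - \<gamma> 0)) {0..t}"
    proof (cases "t \<le> a")
      case True
      then show ?thesis
        using 1[of t] that by simp
    next
      case False
      have "(g has_integral ((\<gamma> a - \<gamma> 0) + (\<gamma> t - \<gamma> a))) {0..t}"
        by (rule has_integral_combine[of 0 a t, OF _ _ 1 2]) (use a False that in auto)
      then show ?thesis by simp
    qed
    then show ?thesis
      by (simp add: integral_unique)
  qed
  ultimately show ?thesis
    unfolding filippov_trajectory_def by blast
qed

definition cycle_path :: "real \<Rightarrow> real^2" where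
  "cycle_path t = (if t \<le> 6/5 then chord t else outer_arc (t - 6/5))"

lemma chord_end: "chord (6/5) = outer_arc 0" "outer_arc arc_time = chord 0"
  by (simp_all add: vec2_eq_iff outer_arc_ends)

lemma cycle_path_late:
  assumes "6/5 \<le> t"
  shows "cycle_path t = outer_arc (t - 6/5)"
proof (cases "t = 6/5")
  case True
  show ?thesis
    unfolding True by (simp add: cycle_path_def chord_end)
qed (use assms in \<open>simp add: cycle_path_def\<close>)

lemma integral_curve_chord: "integral_curve_on X0 cycle_path 0 (6/5)"
  unfolding integral_curve_on_def
proof
  fix t :: real assume t: "t \<in> {0..6/5}"
  have chord_eq: "chord = (\<lambda>t. vector [4/5, - 3/5] + t *\<^sub>R vector [0, 1])"
    by (simp add: fun_eq_iff vec2_eq_iff)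
  have "(chord has_vector_derivative X0 (cycle_path t)) (at t within {0..6/5})"
    unfolding chord_eq X0_def by (auto intro!: derivative_eq_intros)
  then show "(cycle_path has_vector_derivative X0 (cycle_path t)) (at t within {0..6/5})"
    by (rule has_vector_derivative_transform[OF t, rotated]) (simp add: cycle_path_def)
qed

lemma integral_curve_outer_arc: "integral_curve_on Y0 cycle_path (6/5) T"
  unfolding integral_curve_on_def
proof
  fix t :: real assume t: "t \<in> {6/5..T}"
  have "((\<lambda>t. outer_arc (t - 6/5)) has_vector_derivative Y0 (outer_arc (t - 6/5))) (at t within {6/5..T})"
    unfolding outer_arc_def by (auto intro!: derivative_eq_intros simp: vec2_eq_iff)
  then have "((\<lambda>t. outer_arc (t - 6/5)) has_vector_derivative Y0 (cycle_path t)) (at t within {6/5..T})"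
    using t by (simp add: cycle_path_late)
  then show "(cycle_path has_vector_derivative Y0 (cycle_path t)) (at t within {6/5..T})"
    by (rule has_vector_derivative_transform[OF t, rotated]) (simp add: cycle_path_late)
qed

lemma h_ends: "h (chord 0) = 0" "h (outer_arc 0) = 0"
  by (simp_all add: h_def power2_eq_square)

lemma h_cycle_path:
  "t \<in> {0..6/5} \<Longrightarrow> h (cycle_path t) \<le> 0"
  "t \<in> {6/5..6/5 + arc_time} \<Longrightarrow> h (cycle_path t) \<ge> 0"
proof -
  assume t: "t \<in> {0..6/5}"
  then consider "t = 0" | "t = 6/5" | "t \<in> {0<..<6/5}" by force
  then show "h (cycle_path t) \<le> 0"
  proof cases
    case 2
    show ?thesis
      unfolding 2 by (simp add: cycle_path_late h_ends)
  qed (use h_chord_neg[of t] h_ends in \<open>auto simp: cycle_path_def\<close>)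
next
  assume t: "t \<in> {6/5..6/5 + arc_time}"
  then consider "t = 6/5" | "t = 6/5 + arc_time" | "t - 6/5 \<in> {0<..<arc_time}" by force
  then show "h (cycle_path t) \<ge> 0"
  proof cases
    case 1
    show ?thesis
      unfolding 1 by (simp add: cycle_path_late h_ends)
  next
    case 2
    show ?thesis
      unfolding 2 using arc_time_pos by (simp add: cycle_path_late h_ends chord_end)
  next
    case 3
    then show ?thesis
      using h_outer_arc_pos[OF 3] by (simp add: cycle_path_late)
  qed
qed

lemma cycle_path_image: "cycle_path ` {0..6/5 + arc_time} = cycle"
proof -
  have "{0..6/5 + arc_time} = {0..6/5} \<union> {6/5..6/5 + arc_time}"
    using arc_time_pos by auto
  moreover have "cycle_path ` {0..6/5} = chord ` {0..6/5}"
    by (auto simp: cycle_path_def image_def)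
  moreover have "cycle_path ` {6/5..6/5 + arc_time} = outer_arc ` {0..arc_time}"
  proof -
    have "cycle_path ` {6/5..6/5 + arc_time} = outer_arc ` ((\<lambda>t. t - 6/5) ` {6/5..6/5 + arc_time})"
      unfolding image_image by (intro image_cong) (simp_all add: cycle_path_late)
    then show ?thesis by simp
  qed
  ultimately show ?thesis
    by (simp add: cycle_def image_Un)
qed

lemma closed_trajectory_cycle_path: "closed_trajectory X0 Y0 (6/5 + arc_time) cycle_path"
proof -
  have "filippov_trajectory X0 Y0 (6/5 + arc_time) cycle_path"
    using arc_time_pos
    by (intro filippov_trajectory_of_arcs[of _ _ "6/5"] continuous_X0 continuous_Y0
        integral_curve_chord integral_curve_outer_arc h_cycle_path) auto
  moreover have "cycle_path (6/5 + arc_time) = cycle_path 0"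
    using arc_time_pos by (simp add: cycle_path_late chord_end) (simp add: cycle_path_def)
  moreover have "cycle_path 1 \<noteq> cycle_path 0"
    by (simp add: cycle_path_def vec2_eq_iff)
  then have "\<exists>t\<in>{0..6/5 + arc_time}. cycle_path t \<noteq> cycle_path 0"
    using arc_time_pos by (intro bexI[of _ 1]) auto
  ultimately show ?thesis
    using arc_time_pos by (simp add: closed_trajectory_def)
qed

lemma concatenation_of_arcs_cycle_path: "concatenation_of_arcs X0 Y0 (6/5 + arc_time) cycle_path"
proof -
  \<comment> \<open>Two arcs: strict increase is required only for the indices 0 and 1.\<close>
  define \<tau> where "\<tau> = (\<lambda>i::nat. if i = 0 then 0 else if i = 1 then 6/5 else 6/5 + arc_time)"
  have "\<tau> i < \<tau> (Suc i) \<and>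
      (integral_curve_on X0 cycle_path (\<tau> i) (\<tau> (Suc i)) \<and>
         (\<forall>t\<in>{\<tau> i..\<tau> (Suc i)}. h (cycle_path t) \<le> 0) \<or>
       integral_curve_on Y0 cycle_path (\<tau> i) (\<tau> (Suc i)) \<and>
         (\<forall>t\<in>{\<tau> i..\<tau> (Suc i)}. h (cycle_path t) \<ge> 0))" if "i < 2" for i
  proof (cases "i = 0")
    case True
    then have \<tau>: "\<tau> i = 0" "\<tau> (Suc i) = 6/5"
      by (simp_all add: \<tau>_def)
    show ?thesis
      unfolding \<tau> using integral_curve_chord h_cycle_path(1) by simp
  next
    case False
    then have \<tau>: "\<tau> i = 6/5" "\<tau> (Suc i) = 6/5 + arc_time"
      using that by (simp_all add: \<tau>_def)
    show ?thesis
      unfolding \<tau> using integral_curve_outer_arc[of "6/5 + arc_time"] h_cycle_path(2) arc_time_pos by simp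
  qed
  moreover have "\<tau> 0 = 0" "\<tau> 2 = 6/5 + arc_time"
    by (simp_all add: \<tau>_def)
  ultimately show ?thesis
    unfolding concatenation_of_arcs_def by blast
qed

section \<open>Isolation and uniqueness of the cycle\<close>

lemma cycle_Int_S1: "cycle \<inter> S1 = {chord 0, outer_arc 0}"
proof (intro equalityI subsetI)
  fix z assume z: "z \<in> cycle \<inter> S1"
  then consider t where "t \<in> {0..6/5}" "z = chord t" | t where "t \<in> {0..arc_time}" "z = outer_arc t"
    by (auto simp: cycle_def)
  then show "z \<in> {chord 0, outer_arc 0}"
  proof cases
    case 1
    then have "t = 0 \<or> t = 6/5"
      using h_chord_neg[of t] z by (force simp: mem_S1_iff)
    then have "z = chord 0 \<or> z = chord (6/5)"
      using 1(2) by blast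
    then show ?thesis
      by (simp add: chord_end)
  next
    case 2
    then have "t = 0 \<or> t = arc_time"
      using h_outer_arc_pos[of t] z by (force simp: mem_S1_iff)
    then have "z = outer_arc 0 \<or> z = outer_arc arc_time"
      using 2(2) by blast
    then show ?thesis
      by (auto simp: chord_end)
  qed
next
  fix z assume "z \<in> {chord 0, outer_arc 0}"
  then show "z \<in> cycle \<inter> S1"
    using h_ends arc_time_pos by (auto simp: cycle_def mem_S1_iff)
qed

lemma cycle_crossing: "cycle \<inter> S1 \<subseteq> crossing_region X0 Y0"
  by (simp add: cycle_Int_S1 crossing_region_def mem_S1_iff h_ends lie_h_X0 lie_h_Y0)

text \<open>The isolating neighbourhood removes from the plane only points of the circle: those
  outside the crossing region and those with abscissa at most 39/50. A Filippov orbit in what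
  remains therefore satisfies the hypotheses of \<open>closed_trajectory_eq_cycle\<close>.\<close>

lemma crossing_limit_cycle_cycle: "crossing_limit_cycle X0 Y0 cycle"
proof -
  define K where "K = {z \<in> S1. lie_h X0 z * lie_h Y0 z \<le> 0 \<or> z$1 \<le> 39/50}"
  have "closed K"
  proof -
    have "K = {z. h z = 0} \<inter> ({z. lie_h X0 z * lie_h Y0 z \<le> 0} \<union> {z. z$1 \<le> 39/50})"
      by (auto simp: K_def mem_S1_iff)
    moreover have "closed \<dots>"
      unfolding lie_h_X0 lie_h_Y0
      by (intro closed_Int closed_Un closed_Collect_eq closed_Collect_le continuous_on_h continuous_intros)
    ultimately show ?thesis by simp
  qed
  then have "open (- K)"
    by (rule open_Compl)
  moreover have "cycle \<subseteq> - K"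
  proof -
    have "z \<in> crossing_region X0 Y0 \<and> z$1 = 4/5" if "z \<in> cycle \<inter> S1" for z
      using that cycle_crossing cycle_Int_S1 by auto
    then show ?thesis
      by (force simp: K_def crossing_region_def)
  qed
  moreover have "\<Gamma>' = cycle" if "periodic_orbit X0 Y0 \<Gamma>'" "\<Gamma>' \<subseteq> - K" for \<Gamma>'
  proof -
    obtain T \<gamma> where "closed_trajectory X0 Y0 T \<gamma>" "\<Gamma>' = \<gamma> ` {0..T}"
      using \<open>periodic_orbit X0 Y0 \<Gamma>'\<close> unfolding periodic_orbit_def by blast
    moreover have "\<Gamma>' \<inter> S1 \<subseteq> crossing_region X0 Y0" "\<forall>z\<in>\<Gamma>' \<inter> S1. z$1 > 39/50"
      using that(2) by (fastforce simp: K_def crossing_region_def not_le)+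
    ultimately show ?thesis
      using closed_trajectory_eq_cycle by metis
  qed
  moreover have "crossing_periodic_orbit X0 Y0 cycle"
    unfolding crossing_periodic_orbit_def
    using closed_trajectory_cycle_path concatenation_of_arcs_cycle_path cycle_path_image cycle_crossing
    by blast
  ultimately show ?thesis
    unfolding crossing_limit_cycle_def by blast
qed

theorem corollary8:
  "\<exists>X Y. (X, Y) \<in> X1S1 \<and> (\<exists>!\<Gamma>. crossing_limit_cycle X Y \<Gamma> \<and> card (\<Gamma> \<inter> S1) = 2)"
proof (intro exI conjI)
  show "(X0, Y0) \<in> X1S1"
    by (rule X0_Y0_in_X1S1)
  show "\<exists>!\<Gamma>. crossing_limit_cycle X0 Y0 \<Gamma> \<and> card (\<Gamma> \<inter> S1) = 2"
  proof (rule ex1I[of _ cycle])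
    have "chord 0 \<noteq> outer_arc 0"
      by (simp add: vec2_eq_iff)
    then show "crossing_limit_cycle X0 Y0 cycle \<and> card (cycle \<inter> S1) = 2"
      by (simp add: crossing_limit_cycle_cycle cycle_Int_S1)
  next
    fix \<Gamma> assume \<Gamma>: "crossing_limit_cycle X0 Y0 \<Gamma> \<and> card (\<Gamma> \<inter> S1) = 2"
    then have "crossing_periodic_orbit X0 Y0 \<Gamma>"
      by (simp add: crossing_limit_cycle_def)
    then obtain T \<gamma> where "closed_trajectory X0 Y0 T \<gamma>" "\<Gamma> = \<gamma> ` {0..T}"
        "\<Gamma> \<inter> S1 \<subseteq> crossing_region X0 Y0"
      unfolding crossing_periodic_orbit_def by blast
    \<comment> \<open>The count of two points on the circle supplies the second alternative of
      \<open>unique\<close>.\<close>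
    then show "\<Gamma> = cycle"
      using closed_trajectory_eq_cycle[of T \<gamma>] \<Gamma> by simp
  qed
qed

end
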